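(* Let $q \in W_1^2[0,1]$ be a real-valued function satisfying $q^{(k)}(0)=q^{(k)}(1)$ for $k=0,1$. Let $L(q)$ be the operator in $L_2(0,1)$ generated by the expression $-y''+q(x)y$ and the Dirichlet boundary conditions $y(0)=y(1)=0$. If $\{(n\pi)^2 : n\in\mathbb{N}\}$ is a subset of the spectrum of $L(q)$, then $q=0$ almost everywhere on $(0,1)$.
   Context: $W_1^2[0,1]$ denotes the Sobolev space of functions $q$ on $[0,1]$ such that $q$ and $q'$ are absolutely continuous and $q''\in L^1[0,1]$. $\mathbb{N}=\{1,2,3,\dots\}$. *)

theory Defs
  imports "HOL-Analysis.Analysis"
begin

text \<open>Functions on \<open>[0,1]\<close> are represented by total functions on \<^typ>\<open>real\<close>; values outside
  \<open>[0,1]\<close> are irrelevant. Members of \<open>L\<^sub>2(0,1)\<close> are represented by functions, and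
  equality in \<open>L\<^sub>2(0,1)\<close> is equality almost everywhere.\<close>

text \<open>The usual \<open>\<epsilon>\<close>-\<open>\<delta>\<close> absolute continuity. A division of its own union is an arbitrary finite
  family of nonempty closed intervals with pairwise disjoint interiors.\<close>

definition absolutely_continuous_on_interval ::
    "real \<Rightarrow> real \<Rightarrow> (real \<Rightarrow> 'a::real_normed_vector) \<Rightarrow> bool" where
  "absolutely_continuous_on_interval a b f \<longleftrightarrow>
     (\<forall>\<epsilon>>0. \<exists>\<delta>>0. \<forall>\<D>. \<D> division_of \<Union>\<D> \<and> \<Union>\<D> \<subseteq> {a..b} \<and>
        (\<Sum>K\<in>\<D>. Sup K - Inf K) < \<delta> \<longrightarrow> (\<Sum>K\<in>\<D>. norm (f (Sup K) - f (Inf K))) < \<epsilon>)"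

text \<open>The derivative on \<open>[0,1]\<close>, one-sided at the endpoints. The value is meaningful only where the
  derivative exists.\<close>

definition deriv01 :: "(real \<Rightarrow> 'a::real_normed_vector) \<Rightarrow> real \<Rightarrow> 'a" where
  "deriv01 f x = vector_derivative f (at x within {0..1})"

text \<open>\<open>f\<close> and \<open>f'\<close> are absolutely continuous on \<open>[0,1]\<close>. The last conjunct is implied by the
  absolute continuity of \<open>f'\<close> and is stated only to make the meaning of \<open>f''\<close> explicit.\<close>

definition twice_AC :: "(real \<Rightarrow> 'a::euclidean_space) \<Rightarrow> bool" where
  "twice_AC f \<longleftrightarrow>
     f differentiable_on {0..1} \<and>
     absolutely_continuous_on_interval 0 1 f \<and>
     absolutely_continuous_on_interval 0 1 (deriv01 f) \<and>
     (AE x in lebesgue_on {0..1}. deriv01 f differentiable (at x within {0..1}))"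

definition sobolev_W21 :: "(real \<Rightarrow> real) set" where
  "sobolev_W21 = {q. twice_AC q \<and> integrable (lebesgue_on {0..1}) (deriv01 (deriv01 q))}"

definition L2 :: "(real \<Rightarrow> complex) set" where
  "L2 = {f \<in> borel_measurable (lebesgue_on {0<..<1}).
           integrable (lebesgue_on {0<..<1}) (\<lambda>x. (cmod (f x))\<^sup>2)}"

definition L2_norm :: "(real \<Rightarrow> complex) \<Rightarrow> real" where
  "L2_norm f = sqrt (LINT x|lebesgue_on {0<..<1}. (cmod (f x))\<^sup>2)"

definition ae_eq :: "(real \<Rightarrow> complex) \<Rightarrow> (real \<Rightarrow> complex) \<Rightarrow> bool" (infix \<open>\<doteq>\<close> 50) where
  "f \<doteq> g \<longleftrightarrow> (AE x in lebesgue_on {0<..<1}. f x = g x)"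

text \<open>An unbounded operator in \<open>L\<^sub>2(0,1)\<close> is given by its graph, a set of pairs \<open>(u, v)\<close>, saturated
  under a.e. equality, with \<open>u\<close> in the domain and \<open>v\<close> the image of \<open>u\<close>. The number \<open>\<mu>\<close> is in the
  resolvent set iff \<open>T - \<mu>\<close> maps the domain bijectively onto \<open>L\<^sub>2(0,1)\<close> with bounded inverse.\<close>

definition resolvent_set :: "((real \<Rightarrow> complex) \<times> (real \<Rightarrow> complex)) set \<Rightarrow> complex set" where
  "resolvent_set T = {\<mu>.
     (\<forall>f\<in>L2. \<exists>(u, v)\<in>T. (\<lambda>x. v x - \<mu> * u x) \<doteq> f) \<and>
     (\<forall>(u, v)\<in>T. (\<lambda>x. v x - \<mu> * u x) \<doteq> (\<lambda>_. 0) \<longrightarrow> u \<doteq> (\<lambda>_. 0)) \<and>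
     (\<exists>C. \<forall>(u, v)\<in>T. L2_norm u \<le> C * L2_norm (\<lambda>x. v x - \<mu> * u x))}"

definition op_spectrum :: "((real \<Rightarrow> complex) \<times> (real \<Rightarrow> complex)) set \<Rightarrow> complex set" where
  "op_spectrum T = - resolvent_set T"

text \<open>The operator has the maximal domain: all \<open>y\<close> with \<open>y\<close>, \<open>y'\<close> absolutely continuous,
  \<open>y(0) = y(1) = 0\<close> and \<open>- y'' + q y\<close> in \<open>L\<^sub>2(0,1)\<close>.\<close>

definition dirichlet_operator ::
    "(real \<Rightarrow> real) \<Rightarrow> ((real \<Rightarrow> complex) \<times> (real \<Rightarrow> complex)) set" where
  "dirichlet_operator q = {(u, v). u \<in> L2 \<and> v \<in> L2 \<and>
     (\<exists>y. twice_AC y \<and> y 0 = 0 \<and> y 1 = 0 \<and> u \<doteq> y \<and>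
        v \<doteq> (\<lambda>x. - deriv01 (deriv01 y) x + of_real (q x) * y x))}"

end

theory Submission
  imports Defs
begin

text \<open>Write \<open>k = n\<pi>\<close> and \<open>Q(x) = \<integral>\<^sub>0\<^sup>x q\<close>. If \<open>k\<^sup>2\<close> is a Dirichlet eigenvalue with eigenfunction \<open>\<phi>\<close>, then
  \<open>\<phi>\<close> is orthogonal to \<open>(q - k\<^sup>2) z - z''\<close> for every test function \<open>z\<close> with \<open>z(0) = z(1) = 0\<close>
  (\<open>lagrange_identity\<close>). Two choices of \<open>z\<close> give moments of the form \<open>\<integral> \<phi> r sin kx = 0\<close> with \<open>r\<close> independent
  of \<open>k\<close>:

  \<^item> \<open>z = sin kx\<close> gives \<open>r = q\<close>;
  \<^item> the WKB approximation \<open>z = (1 + a/k\<^sup>2) sin kx - (Q/2k) cos kx\<close> with \<open>a = q/4 - Q\<^sup>2/8\<close> gives, up to the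
    factor \<open>-1/k\<^sup>2\<close>, \<open>r = a'' - q a\<close>. It vanishes at 1 because the first choice yields \<open>Q(1) = 0\<close>.

  Since \<open>\<phi> = sin kx + O(1/k)\<close> uniformly after normalization, letting \<open>n \<rightarrow> \<infinity>\<close> gives \<open>\<integral> r = 0\<close>
  (\<open>integral_eq_0_if_near_sine_moments\<close>). Now \<open>\<integral> a'' = a'(1) - a'(0) = (q'(1) - q'(0))/4 = 0\<close> and
  \<open>\<integral> q Q\<^sup>2 = Q(1)\<^sup>3/3 = 0\<close>, so that \<open>0 = \<integral> q a = \<integral> q\<^sup>2 / 4\<close>, and \<open>q = 0\<close>. Only large \<open>n\<close> are needed.

  It remains to pass from the spectrum to eigenfunctions
  (\<open>resolvent_set_dirichlet_operator\<close>): if the solution \<open>\<phi>\<close> with \<open>\<phi>(0) = 0\<close>, \<open>\<phi>'(0) = k\<close> has \<open>\<phi>(1) \<noteq> 0\<close>,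
  then the Dirichlet problem is uniquely solvable with bounded inverse. For \<open>k \<ge> 2 sup |q|\<close> the solution \<open>\<phi>\<close>
  and all bounds come from the Volterra equation \<open>y(x) = g(x) + k\<^sup>-\<^sup>1 \<integral>\<^sub>0\<^sup>x sin k(x - t) q(t) y(t) dt\<close>,
  which is a contraction in the sup norm. As the operator is defined on functions with absolutely continuous
  derivative, this needs two classical facts: the fundamental theorem of calculus for absolutely
  continuous functions, and Lebesgue's differentiation theorem on the line.\<close>

section \<open>Absolutely continuous functions\<close>

lemma AC_subinterval:
  assumes "absolutely_continuous_on_interval a b f" "{c..d} \<subseteq> {a..b}"
  shows "absolutely_continuous_on_interval c d f"
  using assms unfolding absolutely_continuous_on_interval_def by (meson order.trans)

text \<open>Domination: a function whose increments are bounded by a linear combination of the increments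
  of two absolutely continuous functions is absolutely continuous.\<close>

lemma AC_dominated:
  assumes f: "absolutely_continuous_on_interval a b f" and g: "absolutely_continuous_on_interval a b g"
    and "A \<ge> 0" "B \<ge> 0"
    and le: "\<And>u v. \<lbrakk>a \<le> u; u \<le> v; v \<le> b\<rbrakk> \<Longrightarrow>
               norm (h v - h u) \<le> A * norm (f v - f u) + B * norm (g v - g u)"
  shows "absolutely_continuous_on_interval a b h"
  unfolding absolutely_continuous_on_interval_def
proof (intro allI impI)
  fix e :: real assume "e > 0"
  then have e1: "e / (2 * (A + 1)) > 0" and e2: "e / (2 * (B + 1)) > 0" using assms(3,4) by simp_all
  obtain d1 where "d1 > 0" and d1: "\<And>\<D>. \<D> division_of \<Union>\<D> \<and> \<Union>\<D> \<subseteq> {a..b} \<and>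
      (\<Sum>K\<in>\<D>. Sup K - Inf K) < d1 \<Longrightarrow> (\<Sum>K\<in>\<D>. norm (f (Sup K) - f (Inf K))) < e / (2 * (A + 1))"
    using f e1 unfolding absolutely_continuous_on_interval_def by meson
  obtain d2 where "d2 > 0" and d2: "\<And>\<D>. \<D> division_of \<Union>\<D> \<and> \<Union>\<D> \<subseteq> {a..b} \<and>
      (\<Sum>K\<in>\<D>. Sup K - Inf K) < d2 \<Longrightarrow> (\<Sum>K\<in>\<D>. norm (g (Sup K) - g (Inf K))) < e / (2 * (B + 1))"
    using g e2 unfolding absolutely_continuous_on_interval_def by meson
  have "(\<Sum>K\<in>\<D>. norm (h (Sup K) - h (Inf K))) < e"
    if D: "\<D> division_of \<Union>\<D>" "\<Union>\<D> \<subseteq> {a..b}" "(\<Sum>K\<in>\<D>. Sup K - Inf K) < min d1 d2" for \<D>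
  proof -
    let ?F = "\<Sum>K\<in>\<D>. norm (f (Sup K) - f (Inf K))"
    let ?G = "\<Sum>K\<in>\<D>. norm (g (Sup K) - g (Inf K))"
    have "(\<Sum>K\<in>\<D>. norm (h (Sup K) - h (Inf K)))
        \<le> (\<Sum>K\<in>\<D>. A * norm (f (Sup K) - f (Inf K)) + B * norm (g (Sup K) - g (Inf K)))"
    proof (rule sum_mono)
      fix K assume K: "K \<in> \<D>"
      obtain u v where uv: "K = cbox u v" "K \<noteq> {}" using division_ofD(3,4)[OF D(1) K] by blast
      moreover have "K \<subseteq> {a..b}" using K D(2) by blast
      ultimately have "u \<le> v" "u \<in> {a..b}" "v \<in> {a..b}" by auto
      then show "norm (h (Sup K) - h (Inf K))
          \<le> A * norm (f (Sup K) - f (Inf K)) + B * norm (g (Sup K) - g (Inf K))"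
        using uv le by simp
    qed
    also have "\<dots> = A * ?F + B * ?G" by (simp add: sum.distrib sum_distrib_left)
    also have "\<dots> \<le> A * (e / (2 * (A + 1))) + B * (e / (2 * (B + 1)))"
      using d1[of \<D>] d2[of \<D>] D assms(3,4) by (intro add_mono mult_left_mono) (auto intro: less_imp_le)
    also have "\<dots> < e / 2 + e / 2"
      using \<open>e > 0\<close> assms(3,4) by (intro add_strict_mono) (simp_all add: field_simps)
    finally show ?thesis by simp
  qed
  then show "\<exists>\<delta>>0. \<forall>\<D>. \<D> division_of \<Union>\<D> \<and> \<Union>\<D> \<subseteq> {a..b} \<and>
      (\<Sum>K\<in>\<D>. Sup K - Inf K) < \<delta> \<longrightarrow> (\<Sum>K\<in>\<D>. norm (h (Sup K) - h (Inf K))) < e"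
    using \<open>d1 > 0\<close> \<open>d2 > 0\<close> by (intro exI[of _ "min d1 d2"]) auto
qed

lemma AC_cong:
  assumes "absolutely_continuous_on_interval a b f" "\<And>x. x \<in> {a..b} \<Longrightarrow> f x = g x"
  shows "absolutely_continuous_on_interval a b g"
  by (rule AC_dominated[OF assms(1) assms(1), of 1 0]) (simp_all add: assms(2)[symmetric])

lemma AC_ident: "absolutely_continuous_on_interval a b (\<lambda>x. x)"
  unfolding absolutely_continuous_on_interval_def
proof (intro allI impI exI conjI)
  fix e :: real and \<D>
  assume D: "\<D> division_of \<Union>\<D> \<and> \<Union>\<D> \<subseteq> {a..b} \<and> (\<Sum>K\<in>\<D>. Sup K - Inf K) < e"
  have "norm (Sup K - Inf K) = Sup K - Inf K" if K: "K \<in> \<D>" for K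
  proof -
    obtain u v where "K = cbox u v" "K \<noteq> {}" using division_ofD(3,4)[of \<D> "\<Union>\<D>", OF _ K] D by blast
    then show ?thesis by auto
  qed
  then show "(\<Sum>K\<in>\<D>. norm (Sup K - Inf K)) < e" using D by simp
qed

lemma AC_lipschitz:
  assumes "\<And>u v. \<lbrakk>a \<le> u; u \<le> v; v \<le> b\<rbrakk> \<Longrightarrow> norm (h v - h u) \<le> L * (v - u)"
  shows "absolutely_continuous_on_interval a b h"
proof (rule AC_dominated[OF AC_ident AC_ident, of "\<bar>L\<bar>" 0])
  fix u v assume "a \<le> u" "u \<le> v" "v \<le> b"
  then have "norm (h v - h u) \<le> L * (v - u)" "L * (v - u) \<le> \<bar>L\<bar> * (v - u)"
    using assms by (auto intro!: mult_right_mono)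
  then show "norm (h v - h u) \<le> \<bar>L\<bar> * norm (v - u) + 0 * norm (v - u)"
    using \<open>u \<le> v\<close> by simp
qed simp_all

lemma AC_add:
  assumes "absolutely_continuous_on_interval a b f" "absolutely_continuous_on_interval a b g"
  shows "absolutely_continuous_on_interval a b (\<lambda>x. f x + g x)"
  by (rule AC_dominated[OF assms, of 1 1]) (auto intro: norm_diff_triangle_ineq)

lemma AC_diff:
  assumes "absolutely_continuous_on_interval a b f" "absolutely_continuous_on_interval a b g"
  shows "absolutely_continuous_on_interval a b (\<lambda>x. f x - g x)"
proof (rule AC_dominated[OF assms, of 1 1])
  fix u v
  have "f v - g v - (f u - g u) = (f v - f u) - (g v - g u)" by simp
  then show "norm (f v - g v - (f u - g u)) \<le> 1 * norm (f v - f u) + 1 * norm (g v - g u)"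
    using norm_triangle_ineq4 by (metis mult_1)
qed auto

lemma AC_imp_continuous_on:
  assumes "absolutely_continuous_on_interval a b f"
  shows "continuous_on {a..b} f"
  unfolding continuous_on_iff
proof (intro ballI allI impI)
  fix x e :: real assume x: "x \<in> {a..b}" and "e > 0"
  then obtain d where "d > 0" and d: "\<And>\<D>. \<D> division_of \<Union>\<D> \<and> \<Union>\<D> \<subseteq> {a..b} \<and>
      (\<Sum>K\<in>\<D>. Sup K - Inf K) < d \<Longrightarrow> (\<Sum>K\<in>\<D>. norm (f (Sup K) - f (Inf K))) < e"
    using assms unfolding absolutely_continuous_on_interval_def by meson
  have *: "norm (f v - f u) < e" if "u \<in> {a..b}" "v \<in> {a..b}" "u \<le> v" "v - u < d" for u v
    using d[of "{cbox u v}"] that division_of_self[of u v] by auto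
  have "dist (f y) (f x) < e" if "y \<in> {a..b}" "dist y x < d" for y
    using *[of x y] *[of y x] x that
    by (cases "x \<le> y") (auto simp: dist_norm norm_minus_commute)
  then show "\<exists>d>0. \<forall>y\<in>{a..b}. dist y x < d \<longrightarrow> dist (f y) (f x) < e"
    using \<open>d > 0\<close> by blast
qed

lemma AC_scaleR:
  fixes f :: "real \<Rightarrow> real" and g :: "real \<Rightarrow> 'a::real_normed_vector"
  assumes f: "absolutely_continuous_on_interval a b f" and g: "absolutely_continuous_on_interval a b g"
  shows "absolutely_continuous_on_interval a b (\<lambda>x. f x *\<^sub>R g x)"
proof -
  have "bounded (f ` {a..b})" "bounded (g ` {a..b})"
    using AC_imp_continuous_on[OF f] AC_imp_continuous_on[OF g]
    by (simp_all add: compact_continuous_image compact_imp_bounded)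
  then obtain F G where F: "\<And>x. x \<in> {a..b} \<Longrightarrow> norm (f x) \<le> F" "F > 0"
    and G: "\<And>x. x \<in> {a..b} \<Longrightarrow> norm (g x) \<le> G" "G > 0"
    by (fastforce simp: bounded_pos)
  show ?thesis
  proof (rule AC_dominated[OF f g, of G F])
    fix u v assume uv: "a \<le> u" "u \<le> v" "v \<le> b"
    have "f v *\<^sub>R g v - f u *\<^sub>R g u = (f v - f u) *\<^sub>R g v + f u *\<^sub>R (g v - g u)"
      by (simp add: algebra_simps)
    also have "norm \<dots> \<le> norm (f v - f u) * norm (g v) + norm (f u) * norm (g v - g u)"
      by (metis norm_scaleR norm_triangle_ineq real_norm_def)
    also have "\<dots> \<le> norm (f v - f u) * G + F * norm (g v - g u)"
      using F(1)[of u] G(1)[of v] uv by (intro add_mono mult_left_mono mult_right_mono) auto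
    finally show "norm (f v *\<^sub>R g v - f u *\<^sub>R g u) \<le> G * norm (f v - f u) + F * norm (g v - g u)"
      by (simp add: mult.commute)
  qed (use F G in auto)
qed

lemma AC_mult:
  fixes f g :: "real \<Rightarrow> real"
  assumes "absolutely_continuous_on_interval a b f" "absolutely_continuous_on_interval a b g"
  shows "absolutely_continuous_on_interval a b (\<lambda>x. f x * g x)"
  using AC_scaleR[OF assms] by simp

text \<open>A function with a continuous derivative on a compact interval is Lipschitz.\<close>

lemma AC_C1:
  fixes f :: "real \<Rightarrow> 'a::real_normed_vector"
  assumes der: "\<And>x. x \<in> {a..b} \<Longrightarrow> (f has_vector_derivative f' x) (at x within {a..b})"
    and cont: "continuous_on {a..b} f'"
  shows "absolutely_continuous_on_interval a b f"
proof -
  have "bounded (f' ` {a..b})"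
    using cont by (simp add: compact_continuous_image compact_imp_bounded)
  then obtain L where L: "\<And>x. x \<in> {a..b} \<Longrightarrow> norm (f' x) \<le> L"
    by (metis bounded_iff image_eqI)
  show ?thesis
  proof (rule AC_lipschitz)
    fix u v assume uv: "a \<le> u" "u \<le> v" "v \<le> b"
    have "norm (f v - f u) \<le> L * norm (v - u)"
    proof (rule differentiable_bound[of "{a..b}" f "\<lambda>x h. h *\<^sub>R f' x"])
      fix x assume x: "x \<in> {a..b}"
      show "(f has_derivative (\<lambda>h. h *\<^sub>R f' x)) (at x within {a..b})"
        using der[OF x] by (simp add: has_vector_derivative_def)
      show "onorm (\<lambda>h. h *\<^sub>R f' x) \<le> L"
        by (rule onorm_le) (use L[OF x] in \<open>simp add: mult.commute[of L] mult_left_mono\<close>)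
    qed (use uv in auto)
    then show "norm (f v - f u) \<le> L * (v - u)" using uv by simp
  qed
qed

text \<open>Different tags of a tagged partial division can carry the same interval only if it is degenerate.\<close>

lemma tagged_partial_sum_eq_division_sum:
  fixes p :: "(real \<times> real set) set"
  assumes p: "p tagged_partial_division_of {a..b}" and "\<And>u. h {u} = 0"
  shows "(\<Sum>(x,K)\<in>p. h K) = (\<Sum>K\<in>snd ` p. h K)"
proof -
  have "sum h (snd ` p) = sum (h \<circ> snd) p"
  proof (rule sum.reindex_nontrivial)
    show "finite p" using tagged_partial_division_ofD(1)[OF p] .
    fix y z assume yz: "y \<in> p" "z \<in> p" "y \<noteq> z" "snd y = snd z"
    obtain x1 K x2 where y: "y = (x1, K)" "z = (x2, K)" using yz(4) by (metis prod.collapse)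
    have "interior K = {}"
      using tagged_partial_division_ofD(5)[OF p] yz y by blast
    moreover obtain u v where "K = cbox u v" "x1 \<in> K"
      using tagged_partial_division_ofD(2,4)[OF p] yz(1) y(1) by blast
    ultimately have "K = {u}" by (auto simp: box_ne_empty)
    then show "h (snd y) = 0" using y assms(2) by simp
  qed
  then show ?thesis by (simp add: comp_def split_def)
qed

lemma division_sum_length:
  fixes \<D> :: "real set set"
  assumes D: "\<D> division_of \<Union>\<D>"
  shows "(\<Sum>K\<in>\<D>. Sup K - Inf K) = measure lebesgue (\<Union>\<D>)"
proof -
  have K: "\<exists>u v. K = cbox u v \<and> u \<le> v" if "K \<in> \<D>" for K
    using division_ofD(3,4)[OF D that] by fastforce
  have "measure lebesgue (\<Union>\<D>) = integral (\<Union>\<D>) (\<lambda>x. 1::real)"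
    using K division_ofD(1)[OF D] by (intro lmeasure_integral fmeasurable.finite_Union) auto
  also have "\<dots> = (\<Sum>K\<in>\<D>. integral K (\<lambda>x. 1::real))"
    using K by (intro integral_combine_division_bottomup[OF D]) auto
  also have "\<dots> = (\<Sum>K\<in>\<D>. Sup K - Inf K)"
    using K by (intro sum.cong) fastforce+
  finally show ?thesis by simp
qed

text \<open>The fundamental theorem of calculus for absolutely continuous functions, in the gauge integral:
  tags at points of differentiability are handled by the derivative, and the intervals tagged in the
  exceptional null set lie in an open set of small measure, so that absolute continuity
  controls the total increment over them.\<close>

theorem AC_fundamental_theorem_of_calculus:
  fixes f :: "real \<Rightarrow> 'a::banach"
  assumes ac: "absolutely_continuous_on_interval a b f" and "a \<le> b" and neg: "negligible S"
    and der: "\<And>x. x \<in> {a..b} - S \<Longrightarrow> (f has_vector_derivative f' x) (at x within {a..b})"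
  shows "(f' has_integral (f b - f a)) {a..b}"
proof -
  \<comment> \<open>the integrand is irrelevant on \<open>S\<close>; the value 0 leaves only the increment of \<open>f\<close> to be bounded there\<close>
  define g where "g = (\<lambda>x. if x \<in> S then 0 else f' x)"
  have "(g has_integral (f b - f a)) (cbox a b)"
    unfolding has_integral
  proof (intro allI impI)
    fix e0 :: real assume "e0 > 0"
    define e where "e = e0 / (2 * (b - a + 1))"
    have "e > 0" "e * (b - a) < e0 / 2"
      using \<open>e0 > 0\<close> \<open>a \<le> b\<close> by (auto simp: e_def field_simps)
    have "\<forall>x. \<exists>d>0. x \<in> {a..b} - S \<longrightarrow>
         (\<forall>y\<in>{a..b}. norm (y-x) < d \<longrightarrow> norm (f y - f x - (y-x) *\<^sub>R f' x) \<le> e * norm (y-x))"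
      using der[unfolded has_vector_derivative_def has_derivative_within_alt] \<open>e > 0\<close> by blast
    then obtain d where d: "\<And>x. 0 < d x"
       "\<And>x y. \<lbrakk>x \<in> {a..b} - S; y \<in> {a..b}; norm (y-x) < d x\<rbrakk>
              \<Longrightarrow> norm (f y - f x - (y-x) *\<^sub>R f' x) \<le> e * norm (y-x)"
      by metis
    obtain \<delta> where "\<delta> > 0" and \<delta>: "\<And>\<D>. \<D> division_of \<Union>\<D> \<and> \<Union>\<D> \<subseteq> {a..b} \<and>
        (\<Sum>K\<in>\<D>. Sup K - Inf K) < \<delta> \<Longrightarrow> (\<Sum>K\<in>\<D>. norm (f (Sup K) - f (Inf K))) < e0 / 2"
      using ac \<open>e0 > 0\<close> unfolding absolutely_continuous_on_interval_def by (meson half_gt_zero)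
    obtain T where T: "open T" "S \<subseteq> T" "T - S \<in> lmeasurable" "emeasure lebesgue (T - S) < ennreal \<delta>"
      using sets_lebesgue_outer_open[OF negligible_imp_sets[OF neg] \<open>\<delta> > 0\<close>] by blast
    have Tm: "T \<in> lmeasurable"
      using T(2,3) negligible_imp_measurable[OF neg]
      by (metis Diff_partition fmeasurable.Un)
    have "measure lebesgue T = measure lebesgue (T - S)"
      using neg Tm by (intro measure_negligible_symdiff[symmetric]) (auto elim: negligible_subset)
    also have "\<dots> < \<delta>"
      using T(3,4) \<open>\<delta> > 0\<close> by (simp add: emeasure_eq_measure2 ennreal_less_iff)
    finally have mT: "measure lebesgue T < \<delta>" .
    define \<gamma> where "\<gamma> = (\<lambda>x. if x \<in> S then T else ball x (d x))"
    have "gauge \<gamma>"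
      using T(1,2) d(1) by (auto simp: gauge_def \<gamma>_def)
    moreover have "norm ((\<Sum>(x,K)\<in>p. measure lborel K *\<^sub>R g x) - (f b - f a)) < e0"
      if ptag: "p tagged_division_of cbox a b" and fine: "\<gamma> fine p" for p
    proof -
      define A where "A = {xk \<in> p. fst xk \<in> S}"
      define \<Phi> where "\<Phi> = (\<lambda>(x,K). measure lborel K *\<^sub>R g x - (f (Sup K) - f (Inf K)))"
      have "finite p" and part: "p tagged_partial_division_of {a..b}"
        using ptag tagged_division_of_finite[OF ptag] by (auto simp: tagged_division_of_def)
      have Ap: "A \<subseteq> p" and partA: "A tagged_partial_division_of {a..b}"
        using tagged_partial_division_subset[OF part] by (auto simp: A_def)
      have ba: "b - a = (\<Sum>(x,K)\<in>p. Sup K - Inf K)" "f b - f a = (\<Sum>(x,K)\<in>p. f(Sup K) - f(Inf K))"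
        using additive_tagged_division_1[where f= "\<lambda>x. x"] additive_tagged_division_1[where f= f]
            \<open>a \<le> b\<close> ptag by auto
      have len: "Sup K - Inf K \<ge> 0" if "(x,K) \<in> p" for x K
        using tagged_partial_division_ofD(2,4)[OF part that] by fastforce
      have good: "norm (\<Phi> xk) \<le> e * (case xk of (x,K) \<Rightarrow> Sup K - Inf K)" if "xk \<in> p - A" for xk
      proof -
        obtain x K where xk: "xk = (x,K)" by force
        have xK: "(x,K) \<in> p" "x \<notin> S" using that xk by (auto simp: A_def)
        then have "x \<in> K" and kab: "K \<subseteq> cbox a b"
          using ptag by blast+
        then obtain u v where k: "K = cbox u v"
          using ptag \<open>(x, K) \<in> p\<close> by auto
        have "u \<le> v" using \<open>x \<in> K\<close> unfolding k by auto
        have ball: "y \<in> ball x (d x)" if "y \<in> K" for y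
          using fine xK that by (force simp: fine_def \<gamma>_def)
        have uv: "u \<in> K" "v \<in> K" by (simp_all add: \<open>u \<le> v\<close> k)
        have "norm ((v - u) *\<^sub>R f' x - (f v - f u))
            = norm (f u - f x - (u - x) *\<^sub>R f' x - (f v - f x - (v - x) *\<^sub>R f' x))"
          by (auto simp: algebra_simps)
        also have "\<dots> \<le> norm (f u - f x - (u - x) *\<^sub>R f' x) + norm (f v - f x - (v - x) *\<^sub>R f' x)"
          by (rule norm_triangle_ineq4)
        also have "\<dots> \<le> e * norm (u - x) + e * norm (v - x)"
          using uv ball[of u] ball[of v] \<open>x \<in> K\<close> kab xK(2)
          by (intro add_mono d) (auto simp: dist_real_def)
        also have "\<dots> = e * (Sup K - Inf K)"
          using \<open>x \<in> K\<close> \<open>u \<le> v\<close> by (auto simp: k algebra_simps)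
        finally show ?thesis using \<open>u \<le> v\<close> xK by (simp add: xk \<Phi>_def k g_def)
      qed
      have bad: "(\<Sum>xk\<in>A. norm (\<Phi> xk)) < e0 / 2"
      proof -
        have D: "snd ` A division_of \<Union>(snd ` A)"
          using partial_division_of_tagged_division[OF partA] .
        have Am: "\<Union>(snd ` A) \<in> sets lebesgue"
          using division_ofD(4)[OF D] division_ofD(1)[OF D]
          by (intro sets.finite_Union) (metis lebesgue_closedin closed_cbox lmeasurable_cbox fmeasurableD subsetI)+
        have "\<Union>(snd ` A) \<subseteq> T"
          using fine by (fastforce simp: fine_def A_def \<gamma>_def)
        then have "measure lebesgue (\<Union>(snd ` A)) \<le> measure lebesgue T"
          using Tm Am by (intro measure_mono_fmeasurable) auto
        then have small: "(\<Sum>K\<in>snd ` A. Sup K - Inf K) < \<delta>"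
          using mT division_sum_length[OF D] by simp
        have "(\<Sum>xk\<in>A. norm (\<Phi> xk)) = (\<Sum>(x,K)\<in>A. norm (f (Sup K) - f (Inf K)))"
          by (intro sum.cong) (auto simp: A_def \<Phi>_def g_def norm_minus_commute)
        also have "\<dots> = (\<Sum>K\<in>snd ` A. norm (f (Sup K) - f (Inf K)))"
          by (rule tagged_partial_sum_eq_division_sum[OF partA]) simp
        also have "\<dots> < e0 / 2"
          using D small tagged_partial_division_ofD(3)[OF partA] by (intro \<delta>) fastforce
        finally show ?thesis .
      qed
      have "(\<Sum>(x,K)\<in>p. measure lborel K *\<^sub>R g x) - (f b - f a) = (\<Sum>xk\<in>p. \<Phi> xk)"
        by (simp add: ba(2) \<Phi>_def split_def sum_subtractf)
      also have "norm \<dots> \<le> (\<Sum>xk\<in>p. norm (\<Phi> xk))" by (rule norm_sum)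
      also have "\<dots> = (\<Sum>xk\<in>p - A. norm (\<Phi> xk)) + (\<Sum>xk\<in>A. norm (\<Phi> xk))"
        using \<open>finite p\<close> Ap by (rule sum.subset_diff[rotated])
      also have "(\<Sum>xk\<in>p - A. norm (\<Phi> xk)) \<le> (\<Sum>xk\<in>p - A. e * (case xk of (x,K) \<Rightarrow> Sup K - Inf K))"
        by (rule sum_mono[OF good])
      also have "\<dots> \<le> (\<Sum>xk\<in>p. e * (case xk of (x,K) \<Rightarrow> Sup K - Inf K))"
        using \<open>finite p\<close> len \<open>e > 0\<close> by (intro sum_mono2) auto
      also have "\<dots> = e * (b - a)"
        by (simp add: ba(1) sum_distrib_left)
      finally show ?thesis using bad \<open>e * (b - a) < e0 / 2\<close> by simp
    qed
    ultimately show "\<exists>\<gamma>. gauge \<gamma> \<and> (\<forall>p. p tagged_division_of cbox a b \<and> \<gamma> fine p \<longrightarrow>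
        norm ((\<Sum>(x,K)\<in>p. measure lborel K *\<^sub>R g x) - (f b - f a)) < e0)"
      by (intro exI[of _ \<gamma>] conjI allI impI) auto
  qed
  then show ?thesis
    using has_integral_spike[OF neg, of "{a..b}" f' g] by (simp add: g_def)
qed

section \<open>Indefinite integrals of integrable functions\<close>

lemma absolutely_integrable_iff_integrable_lebesgue_on:
  fixes f :: "real \<Rightarrow> 'a::euclidean_space"
  shows "f absolutely_integrable_on {a..b} \<longleftrightarrow> integrable (lebesgue_on {a..b}) f"
  by (simp add: set_integrable_def integrable_restrict_space)

text \<open>Absolute continuity of the Lebesgue integral, by truncation of \<open>|f|\<close> at a height \<open>N\<close>: the part above
  \<open>N\<close> has small integral, and the part below contributes at most \<open>N\<close> times the total length.\<close>

lemma AC_indefinite_integral: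
  fixes f :: "real \<Rightarrow> 'a::euclidean_space"
  assumes f: "f absolutely_integrable_on {a..b}"
  shows "absolutely_continuous_on_interval a b (\<lambda>x. integral {a..x} f)"
  unfolding absolutely_continuous_on_interval_def
proof (intro allI impI)
  fix e :: real assume "e > 0"
  define g where "g = (\<lambda>x. norm (f x))"
  define gN where "gN = (\<lambda>(N::nat) x. min (g x) (real N))"
  have g: "g absolutely_integrable_on {a..b}"
    unfolding g_def using absolutely_integrable_norm[OF f] by (simp add: comp_def)
  have gN: "gN N absolutely_integrable_on {a..b}" for N
    using g unfolding gN_def absolutely_integrable_iff_integrable_lebesgue_on
    by (intro integrable_min integrable_const) auto
  have "(\<lambda>N. integral {a..b} (gN N)) \<longlonglongrightarrow> integral {a..b} g"
  proof (rule dominated_convergence)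
    show "gN N integrable_on {a..b}" for N using gN by (rule set_lebesgue_integral_eq_integral)
    show "g integrable_on {a..b}" using g by (rule set_lebesgue_integral_eq_integral)
    show "norm (gN N x) \<le> g x" for N x by (simp add: gN_def g_def)
    show "(\<lambda>N. gN N x) \<longlonglongrightarrow> g x" for x
    proof (rule tendsto_eventually)
      obtain M where "g x \<le> real M" using real_arch_simple by blast
      then show "\<forall>\<^sub>F N in sequentially. gN N x = g x"
        by (intro eventually_sequentiallyI[of M]) (auto simp: gN_def min_def)
    qed
  qed
  then have "\<forall>\<^sub>F N in sequentially. dist (integral {a..b} (gN N)) (integral {a..b} g) < e / 2"
    using \<open>e > 0\<close> by (intro tendstoD) auto
  then obtain N where "dist (integral {a..b} (gN N)) (integral {a..b} g) < e / 2"
    by (auto simp: eventually_sequentially)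
  then have N: "integral {a..b} g - integral {a..b} (gN N) < e / 2"
    unfolding dist_real_def by linarith
  define \<delta> where "\<delta> = e / (2 * (real N + 1))"
  have "\<delta> > 0" "real N * \<delta> < e / 2" using \<open>e > 0\<close> by (auto simp: \<delta>_def field_simps)
  have "(\<Sum>K\<in>\<D>. norm (integral {a..Sup K} f - integral {a..Inf K} f)) < e"
    if D: "\<D> division_of \<Union>\<D>" "\<Union>\<D> \<subseteq> {a..b}" "(\<Sum>K\<in>\<D>. Sup K - Inf K) < \<delta>" for \<D>
  proof -
    let ?h = "\<lambda>x. g x - gN N x"
    have h: "?h absolutely_integrable_on {a..b}"
      using g gN by (rule set_integral_diff)
    have K: "norm (integral {a..Sup K} f - integral {a..Inf K} f)
               \<le> integral K ?h + real N * (Sup K - Inf K)" "?h integrable_on K" if KD: "K \<in> \<D>" for K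
    proof -
      obtain u v where "K = cbox u v" "K \<noteq> {}" using division_ofD(3,4)[OF D(1) KD] by blast
      then have k: "K = {u..v}" "u \<le> v" by auto
      moreover have "K \<subseteq> {a..b}" using KD D(2) by blast
      ultimately have uv: "a \<le> u" "v \<le> b" "{u..v} \<subseteq> {a..b}" by auto
      have int: "f absolutely_integrable_on {u..v}" "g absolutely_integrable_on {u..v}"
          "gN N absolutely_integrable_on {u..v}" "?h absolutely_integrable_on {u..v}"
        using absolutely_integrable_on_subinterval[OF _ uv(3)] f g gN[of N] h by blast+
      note int' = int[THEN set_lebesgue_integral_eq_integral(1)]
      show "?h integrable_on K" using int'(4) k by simp
      have "f integrable_on {a..v}"
        using f uv by (intro set_lebesgue_integral_eq_integral absolutely_integrable_on_subinterval[OF f]) auto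
      then have "integral {a..v} f - integral {a..u} f = integral {u..v} f"
        using Henstock_Kurzweil_Integration.integral_combine[of a u v f] uv k by (simp add: algebra_simps)
      also have "norm \<dots> \<le> integral {u..v} g"
        unfolding g_def using int'(1,2) by (intro integral_norm_bound_integral) (auto simp: g_def)
      also have "\<dots> = integral {u..v} ?h + integral {u..v} (gN N)"
        using int'(2,3) by (simp add: integral_diff)
      also have "integral {u..v} (gN N) \<le> integral {u..v} (\<lambda>x. real N)"
        using int'(3) by (intro integral_le) (auto simp: gN_def)
      finally show "norm (integral {a..Sup K} f - integral {a..Inf K} f)
               \<le> integral K ?h + real N * (Sup K - Inf K)"
        using k by (simp add: mult.commute)
    qed
    have "(\<Sum>K\<in>\<D>. norm (integral {a..Sup K} f - integral {a..Inf K} f))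
        \<le> (\<Sum>K\<in>\<D>. integral K ?h + real N * (Sup K - Inf K))"
      by (rule sum_mono[OF K(1)])
    also have "\<dots> = integral (\<Union>\<D>) ?h + real N * (\<Sum>K\<in>\<D>. Sup K - Inf K)"
      using integral_combine_division_bottomup[OF D(1) K(2)]
      by (simp add: sum.distrib sum_distrib_left)
    also have "integral (\<Union>\<D>) ?h \<le> integral {a..b} ?h"
      using D(2) h integrable_combine_division[OF D(1) K(2)]
      by (intro integral_subset_le) (auto simp: gN_def set_lebesgue_integral_eq_integral)
    also have "\<dots> < e / 2"
      using N g gN by (simp add: integral_diff set_lebesgue_integral_eq_integral)
    also have "real N * (\<Sum>K\<in>\<D>. Sup K - Inf K) \<le> real N * \<delta>"
      using D(3) by (intro mult_left_mono) auto
    finally show ?thesis using \<open>real N * \<delta> < e / 2\<close> by simp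
  qed
  then show "\<exists>\<delta>>0. \<forall>\<D>. \<D> division_of \<Union>\<D> \<and> \<Union>\<D> \<subseteq> {a..b} \<and>
      (\<Sum>K\<in>\<D>. Sup K - Inf K) < \<delta> \<longrightarrow>
      (\<Sum>K\<in>\<D>. norm (integral {a..Sup K} f - integral {a..Inf K} f)) < e"
    using \<open>\<delta> > 0\<close> by blast
qed

text \<open>Lebesgue's differentiation theorem on the line. One-sided averages
  of the integrand give the right derivative of the indefinite integral; the left derivative follows by
  reflection.\<close>

theorem indefinite_integral_has_vector_derivative_ae:
  fixes f :: "real \<Rightarrow> 'a::euclidean_space"
  assumes f: "f integrable_on {a..b}"
  obtains N where "negligible N"
    "\<And>x. x \<in> {a..b} - N \<Longrightarrow>
       ((\<lambda>x. integral {a..x} f) has_vector_derivative f x) (at x within {a..b})"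
proof -
  \<comment> \<open>extension by zero, so that one-sided averages are defined at all points\<close>
  define f0 where "f0 = (\<lambda>x. if x \<in> {a..b} then f x else 0)"
  have f0: "f0 integrable_on cbox c d" for c d
  proof -
    have "f0 integrable_on UNIV" using f unfolding f0_def by (subst integrable_restrict_UNIV)
    then show ?thesis by (rule integrable_on_subcbox) auto
  qed
  have f0m: "(\<lambda>x. f0 (- x)) integrable_on cbox c d" for c d
    using f0[of "-d" "-c"] Henstock_Kurzweil_Integration.integrable_reflect_real[of f0 "-c" "-d"] by simp
  obtain N1 where N1: "negligible N1" "\<And>x e. \<lbrakk>x \<notin> N1; 0 < e\<rbrakk> \<Longrightarrow>
      \<exists>d>0. \<forall>h. 0 < h \<and> h < d \<longrightarrow> norm (integral {x..x + h} f0 /\<^sub>R h - f0 x) < e"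
    using integrable_ccontinuous_explicit[OF f0] by auto
  obtain N2 where N2: "negligible N2" "\<And>x e. \<lbrakk>x \<notin> N2; 0 < e\<rbrakk> \<Longrightarrow>
      \<exists>d>0. \<forall>h. 0 < h \<and> h < d \<longrightarrow>
        norm (integral {x..x + h} (\<lambda>x. f0 (- x)) /\<^sub>R h - f0 (- x)) < e"
    using integrable_ccontinuous_explicit[OF f0m] by auto
  define N where "N = N1 \<union> uminus ` N2"
  have "negligible (uminus ` N2)"
    using N2(1) by (intro negligible_differentiable_image_negligible) (auto intro!: derivative_intros)
  then have "negligible N" using N1(1) by (simp add: N_def)
  moreover have "((\<lambda>x. integral {a..x} f) has_vector_derivative f x) (at x within {a..b})"
    if x: "x \<in> {a..b} - N" for x
    unfolding has_vector_derivative_def has_derivative_within_alt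
  proof (intro conjI allI impI)
    show "bounded_linear (\<lambda>h. h *\<^sub>R f x)" by (rule bounded_linear_scaleR_left)
    fix e :: real assume "e > 0"
    have "x \<notin> N1" "- x \<notin> N2" using x by (auto simp: N_def image_iff)
    obtain d1 where d1: "d1 > 0" "\<And>h. \<lbrakk>0 < h; h < d1\<rbrakk> \<Longrightarrow>
        norm (integral {x..x + h} f0 /\<^sub>R h - f0 x) < e"
      using N1(2)[OF \<open>x \<notin> N1\<close> \<open>e > 0\<close>] by blast
    obtain d2 where d2: "d2 > 0" "\<And>h. \<lbrakk>0 < h; h < d2\<rbrakk> \<Longrightarrow>
        norm (integral {- x..- x + h} (\<lambda>x. f0 (- x)) /\<^sub>R h - f0 (- (- x))) < e"
      using N2(2)[OF \<open>- x \<notin> N2\<close> \<open>e > 0\<close>] by blast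
    have scale: "norm (I - h *\<^sub>R c) \<le> e * h" if "norm (I /\<^sub>R h - c) < e" "h > 0" for h and I c :: 'a
    proof -
      have "I - h *\<^sub>R c = h *\<^sub>R (I /\<^sub>R h - c)" using \<open>h > 0\<close> by (simp add: algebra_simps)
      also have "norm \<dots> = h * norm (I /\<^sub>R h - c)" using \<open>h > 0\<close> by simp
      also have "\<dots> \<le> h * e" using that by (intro mult_left_mono) auto
      finally show ?thesis by (simp add: mult.commute)
    qed
    have eqI: "integral {u..v} f = integral {u..v} f0" if "a \<le> u" "v \<le> b" for u v
      using that by (intro integral_cong) (auto simp: f0_def)
    have comb: "integral {a..v} f - integral {a..u} f = integral {u..v} f" if "a \<le> u" "u \<le> v" "v \<le> b" for u v
      using Henstock_Kurzweil_Integration.integral_combine[of a u v f] that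
        integrable_on_subinterval[OF f, of a v] by (auto simp: algebra_simps)
    have "norm (integral {a..y} f - integral {a..x} f - (y - x) *\<^sub>R f x) \<le> e * norm (y - x)"
      if y: "y \<in> {a..b}" "norm (y - x) < min d1 d2" for y
    proof -
      consider "y = x" | "y > x" | "y < x" by linarith
      then show ?thesis
      proof cases
        case 1 then show ?thesis by simp
      next
        case 2
        have "norm (integral {x..y} f0 - (y - x) *\<^sub>R f0 x) \<le> e * (y - x)"
          using d1(2)[of "y - x"] 2 y by (intro scale) auto
        moreover have "integral {a..y} f - integral {a..x} f = integral {x..y} f0"
          using comb[of x y] eqI[of x y] 2 x y by simp
        moreover have "f0 x = f x" using x by (simp add: f0_def)
        ultimately show ?thesis using 2 by simp
      next
        case 3
        have "integral {- x..- y} (\<lambda>x. f0 (- x)) = integral {y..x} f0"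
          by (rule Henstock_Kurzweil_Integration.integral_reflect_real)
        then have "norm (integral {y..x} f0 - (x - y) *\<^sub>R f0 x) \<le> e * (x - y)"
          using d2(2)[of "x - y"] 3 y by (intro scale) auto
        moreover have "integral {a..y} f - integral {a..x} f = - integral {y..x} f0"
          using comb[of y x] eqI[of y x] 3 x y by (simp add: algebra_simps)
        moreover have "f0 x = f x" using x by (simp add: f0_def)
        ultimately have "integral {a..y} f - integral {a..x} f - (y - x) *\<^sub>R f x
              = - (integral {y..x} f0 - (x - y) *\<^sub>R f x)"
            "norm (integral {y..x} f0 - (x - y) *\<^sub>R f x) \<le> e * (x - y)"
          by (simp_all add: scaleR_diff_left)
        then show ?thesis using 3 by (simp only: norm_minus_cancel) simp
      qed
    qed
    then show "\<exists>d>0. \<forall>y\<in>{a..b}. norm (y - x) < d \<longrightarrow>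
        norm (integral {a..y} f - integral {a..x} f - (y - x) *\<^sub>R f x) \<le> e * norm (y - x)"
      using d1(1) d2(1) by (intro exI[of _ "min d1 d2"]) auto
  qed
  ultimately show thesis using that by blast
qed

section \<open>Variation of constants\<close>

text \<open>The solution of \<open>y'' + k\<^sup>2 y = h\<close> with \<open>y(0) = y'(0) = 0\<close>, by variation of constants.\<close>

definition sine_volterra :: "real \<Rightarrow> (real \<Rightarrow> 'a) \<Rightarrow> real \<Rightarrow> 'a::euclidean_space" where
  "sine_volterra k h x = integral {0..x} (\<lambda>t. sin (k * (x - t)) *\<^sub>R h t) /\<^sub>R k"

text \<open>Its derivative; the factor \<open>k\<close> from differentiating the sine cancels the division by \<open>k\<close>.\<close>

definition cosine_volterra :: "real \<Rightarrow> (real \<Rightarrow> 'a) \<Rightarrow> real \<Rightarrow> 'a::euclidean_space" where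
  "cosine_volterra k h x = integral {0..x} (\<lambda>t. cos (k * (x - t)) *\<^sub>R h t)"

lemma
  fixes h :: "real \<Rightarrow> 'a::euclidean_space"
  assumes h: "continuous_on {0..1} h" and x: "x \<in> {0..1}"
  shows sine_volterra_split: "sine_volterra k h x =
      (sin (k * x) *\<^sub>R integral {0..x} (\<lambda>t. cos (k * t) *\<^sub>R h t)
        - cos (k * x) *\<^sub>R integral {0..x} (\<lambda>t. sin (k * t) *\<^sub>R h t)) /\<^sub>R k"
    and cosine_volterra_split: "cosine_volterra k h x =
      cos (k * x) *\<^sub>R integral {0..x} (\<lambda>t. cos (k * t) *\<^sub>R h t)
        + sin (k * x) *\<^sub>R integral {0..x} (\<lambda>t. sin (k * t) *\<^sub>R h t)"
proof -
  have h': "continuous_on {0..x} h" using h x by (auto elim: continuous_on_subset)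
  have int: "(\<lambda>t. cos (k * t) *\<^sub>R h t) integrable_on {0..x}" "(\<lambda>t. sin (k * t) *\<^sub>R h t) integrable_on {0..x}"
    by (intro integrable_continuous_real continuous_intros h')+
  have "integral {0..x} (\<lambda>t. sin (k * (x - t)) *\<^sub>R h t) =
      integral {0..x} (\<lambda>t. sin (k * x) *\<^sub>R (cos (k * t) *\<^sub>R h t) - cos (k * x) *\<^sub>R (sin (k * t) *\<^sub>R h t))"
    by (intro integral_cong) (simp add: right_diff_distrib sin_diff scaleR_diff_left)
  also have "\<dots> = sin (k * x) *\<^sub>R integral {0..x} (\<lambda>t. cos (k * t) *\<^sub>R h t)
        - cos (k * x) *\<^sub>R integral {0..x} (\<lambda>t. sin (k * t) *\<^sub>R h t)"
    by (subst integral_diff) (intro integrable_cmul int, intro integrable_cmul int, simp only: integral_cmul)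
  finally show "sine_volterra k h x =
      (sin (k * x) *\<^sub>R integral {0..x} (\<lambda>t. cos (k * t) *\<^sub>R h t)
        - cos (k * x) *\<^sub>R integral {0..x} (\<lambda>t. sin (k * t) *\<^sub>R h t)) /\<^sub>R k"
    by (simp add: sine_volterra_def)
  have "integral {0..x} (\<lambda>t. cos (k * (x - t)) *\<^sub>R h t) =
      integral {0..x} (\<lambda>t. cos (k * x) *\<^sub>R (cos (k * t) *\<^sub>R h t) + sin (k * x) *\<^sub>R (sin (k * t) *\<^sub>R h t))"
    by (intro integral_cong) (simp add: right_diff_distrib cos_diff scaleR_add_left)
  also have "\<dots> = cos (k * x) *\<^sub>R integral {0..x} (\<lambda>t. cos (k * t) *\<^sub>R h t)
        + sin (k * x) *\<^sub>R integral {0..x} (\<lambda>t. sin (k * t) *\<^sub>R h t)"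
    by (subst integral_add) (intro integrable_cmul int, intro integrable_cmul int, simp only: integral_cmul)
  finally show "cosine_volterra k h x =
      cos (k * x) *\<^sub>R integral {0..x} (\<lambda>t. cos (k * t) *\<^sub>R h t)
        + sin (k * x) *\<^sub>R integral {0..x} (\<lambda>t. sin (k * t) *\<^sub>R h t)"
    by (simp add: cosine_volterra_def)
qed

lemma
  fixes h :: "real \<Rightarrow> 'a::euclidean_space"
  assumes h: "continuous_on {0..1} h" and "k \<noteq> 0" and x: "x \<in> {0..1}"
  shows sine_volterra_has_derivative:
      "(sine_volterra k h has_vector_derivative cosine_volterra k h x) (at x within {0..1})"
    and cosine_volterra_has_derivative:
      "(cosine_volterra k h has_vector_derivative h x - k\<^sup>2 *\<^sub>R sine_volterra k h x) (at x within {0..1})"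
proof -
  define C where "C = (\<lambda>x. integral {0..x} (\<lambda>t. cos (k * t) *\<^sub>R h t))"
  define S where "S = (\<lambda>x. integral {0..x} (\<lambda>t. sin (k * t) *\<^sub>R h t))"
  have C: "(C has_vector_derivative cos (k * x) *\<^sub>R h x) (at x within {0..1})"
    unfolding C_def by (intro integral_has_vector_derivative continuous_intros h x)
  have S: "(S has_vector_derivative sin (k * x) *\<^sub>R h x) (at x within {0..1})"
    unfolding S_def by (intro integral_has_vector_derivative continuous_intros h x)
  have s: "((\<lambda>x. sin (k * x)) has_real_derivative k * cos (k * x)) (at x within {0..1})"
    and c: "((\<lambda>x. cos (k * x)) has_real_derivative - (k * sin (k * x))) (at x within {0..1})"
    by (auto intro!: derivative_eq_intros)
  have cx: "cosine_volterra k h x = cos (k * x) *\<^sub>R C x + sin (k * x) *\<^sub>R S x"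
    and sx: "sine_volterra k h x = (sin (k * x) *\<^sub>R C x - cos (k * x) *\<^sub>R S x) /\<^sub>R k"
    by (simp_all only: cosine_volterra_split[OF h x] sine_volterra_split[OF h x] C_def S_def)
  have kk: "k * (inverse k * z) = z" for z
    using \<open>k \<noteq> 0\<close> by (simp flip: mult.assoc)
  have cs: "(cos (k * x) * cos (k * x)) *\<^sub>R h x + ((sin (k * x) * sin (k * x)) *\<^sub>R h x + z) = h x + z" for z
    by (simp flip: add.assoc scaleR_add_left power2_eq_square)
  have "((\<lambda>x. (sin (k * x) *\<^sub>R C x - cos (k * x) *\<^sub>R S x) /\<^sub>R k) has_vector_derivative
      (cos (k * x) *\<^sub>R C x + sin (k * x) *\<^sub>R S x)) (at x within {0..1})"
    using bounded_linear.has_vector_derivative[OF bounded_linear_scaleR_right[of "inverse k"],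
        OF has_vector_derivative_diff[OF has_vector_derivative_scaleR[OF s C] has_vector_derivative_scaleR[OF c S]]]
    by (rule has_vector_derivative_eq_rhs) (use \<open>k \<noteq> 0\<close> in \<open>simp add: algebra_simps kk\<close>)
  then show "(sine_volterra k h has_vector_derivative cosine_volterra k h x) (at x within {0..1})"
    unfolding cx
    by (rule has_vector_derivative_transform[OF x, rotated])
      (simp only: sine_volterra_split[OF h] C_def S_def)
  have "((\<lambda>x. cos (k * x) *\<^sub>R C x + sin (k * x) *\<^sub>R S x) has_vector_derivative
      (h x - k\<^sup>2 *\<^sub>R ((sin (k * x) *\<^sub>R C x - cos (k * x) *\<^sub>R S x) /\<^sub>R k)))
      (at x within {0..1})"
    using has_vector_derivative_add[OF has_vector_derivative_scaleR[OF c C] has_vector_derivative_scaleR[OF s S]]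
    by (rule has_vector_derivative_eq_rhs) (use \<open>k \<noteq> 0\<close> in \<open>simp add: algebra_simps power2_eq_square kk cs cs[of 0, simplified]\<close>)
  then show "(cosine_volterra k h has_vector_derivative h x - k\<^sup>2 *\<^sub>R sine_volterra k h x) (at x within {0..1})"
    unfolding sx
    by (rule has_vector_derivative_transform[OF x, rotated])
      (simp only: cosine_volterra_split[OF h] C_def S_def)
qed

lemma continuous_on_sine_volterra:
  fixes h :: "real \<Rightarrow> 'a::euclidean_space"
  assumes "continuous_on {0..1} h" "k \<noteq> 0"
  shows "continuous_on {0..1} (sine_volterra k h)" "continuous_on {0..1} (cosine_volterra k h)"
  by (rule continuous_on_vector_derivative, erule sine_volterra_has_derivative[OF assms])
    (rule continuous_on_vector_derivative, erule cosine_volterra_has_derivative[OF assms])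

lemma norm_sine_volterra_le:
  fixes h :: "real \<Rightarrow> 'a::euclidean_space"
  assumes int: "(\<lambda>t. sin (k * (x - t)) *\<^sub>R h t) integrable_on {0..x}" and "H integrable_on {0..1}"
    and le: "\<And>t. t \<in> {0..1} \<Longrightarrow> norm (h t) \<le> H t" and "k > 0" and x: "x \<in> {0..1}"
  shows "norm (sine_volterra k h x) \<le> integral {0..1} H / k"
proof -
  have H: "H integrable_on {0..x}"
    using assms(2) by (rule integrable_on_subinterval) (use x in auto)
  have "norm (integral {0..x} (\<lambda>t. sin (k * (x - t)) *\<^sub>R h t)) \<le> integral {0..x} H"
  proof (rule integral_norm_bound_integral[OF int H])
    fix t assume "t \<in> {0..x}"
    then have "norm (h t) \<le> H t" using x le by auto
    moreover have "\<bar>sin (k * (x - t))\<bar> * norm (h t) \<le> 1 * norm (h t)"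
      by (intro mult_right_mono) auto
    ultimately show "norm (sin (k * (x - t)) *\<^sub>R h t) \<le> H t" by simp
  qed
  also have "\<dots> \<le> integral {0..1} H"
    using H assms(2) x by (intro integral_subset_le) (auto intro: order_trans[OF norm_ge_zero le])
  finally show ?thesis using \<open>k > 0\<close> by (simp add: sine_volterra_def field_simps)
qed

lemma sine_volterra_integrand_continuous:
  fixes h :: "real \<Rightarrow> 'a::euclidean_space"
  assumes "continuous_on {0..1} h" "x \<in> {0..1}"
  shows "(\<lambda>t. sin (k * (x - t)) *\<^sub>R h t) integrable_on {0..x}"
  using assms by (intro integrable_continuous_real continuous_intros continuous_on_subset[OF assms(1)]) auto

section \<open>The Volterra equation\<close>

text \<open>For \<open>k \<ge> 2 sup |q|\<close> the Volterra operator is a contraction with factor 1/2 in the sup norm.\<close>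

lemma volterra_equation_solvable:
  fixes g :: "real \<Rightarrow> 'a::euclidean_space" and q :: "real \<Rightarrow> real"
  assumes q: "continuous_on {0..1} q" "\<And>x. x \<in> {0..1} \<Longrightarrow> \<bar>q x\<bar> \<le> M" and k: "k > 0" "2 * M \<le> k"
    and g: "continuous_on {0..1} g"
  obtains w where "continuous_on {0..1} w"
    "\<And>x. x \<in> {0..1} \<Longrightarrow> w x = g x + sine_volterra k (\<lambda>t. q t *\<^sub>R w t) x"
proof -
  \<comment> \<open>the retraction onto the unit interval makes functions on it into bounded continuous functions on the line\<close>
  define r where "r = (\<lambda>x::real. max 0 (min 1 x))"
  define V where "V = (\<lambda>w x. g x + sine_volterra k (\<lambda>t. q t *\<^sub>R w t) x)"
  define T where "T = (\<lambda>w. Bcontfun (\<lambda>x. V (apply_bcontfun w) (r x)))"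
  have r: "continuous_on UNIV r" "r x \<in> {0..1}" "x \<in> {0..1} \<Longrightarrow> r x = x" for x
    by (auto simp: r_def intro!: continuous_intros)
  have cV: "continuous_on {0..1} (V w)" if "continuous_on {0..1} w" for w
    unfolding V_def using that q(1) g k(1) by (intro continuous_intros continuous_on_sine_volterra) auto
  have wc: "continuous_on {0..1} (apply_bcontfun w)" for w :: "real \<Rightarrow>\<^sub>C 'a"
    using apply_bcontfun[of w] by (auto simp: bcontfun_def elim: continuous_on_subset)
  have T: "apply_bcontfun (T w) x = V w (r x)" for w x
  proof -
    have "bounded (V w ` {0..1})"
      using cV[OF wc] by (simp add: compact_continuous_image compact_imp_bounded)
    then obtain b where b: "\<And>x. x \<in> {0..1} \<Longrightarrow> norm (V w x) \<le> b" by (metis bounded_iff image_eqI)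
    have "(\<lambda>x. V (apply_bcontfun w) (r x)) \<in> bcontfun"
    proof (rule bcontfun_normI)
      show "continuous_on UNIV (\<lambda>x. V w (r x))"
        using r(2) by (intro continuous_on_compose2[OF cV[OF wc] r(1)]) auto
      show "norm (V w (r x)) \<le> b" for x using b r(2) by blast
    qed
    then show ?thesis by (simp add: T_def Bcontfun_inverse)
  qed
  have "M \<ge> 0" using q(2)[of 0] by auto
  have "\<exists>!w. T w = w"
  proof (rule banach_fix_type[of "1/2" T], simp, simp, intro allI)
    fix v w :: "real \<Rightarrow>\<^sub>C 'a"
    show "dist (T v) (T w) \<le> 1/2 * dist v w"
    proof (rule dist_bound)
      fix x
      let ?d = "\<lambda>u t. q t *\<^sub>R apply_bcontfun u t"
      have i: "(\<lambda>t. sin (k * (r x - t)) *\<^sub>R ?d u t) integrable_on {0..r x}" for u :: "real \<Rightarrow>\<^sub>C 'a"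
        by (intro sine_volterra_integrand_continuous continuous_intros q(1) wc r(2))
      have "V v (r x) - V w (r x) = sine_volterra k (\<lambda>t. ?d v t - ?d w t) (r x)"
        unfolding V_def sine_volterra_def scaleR_diff_right
        by (subst integral_diff[OF i i]) (simp add: scaleR_diff_right)
      also have "norm \<dots> \<le> integral {0..1} (\<lambda>t::real. M * dist v w) / k"
      proof (rule norm_sine_volterra_le)
        show "(\<lambda>t. sin (k * (r x - t)) *\<^sub>R (?d v t - ?d w t)) integrable_on {0..r x}"
          by (intro sine_volterra_integrand_continuous continuous_intros q(1) wc r(2))
        fix t :: real assume "t \<in> {0..1}"
        have "norm (?d v t - ?d w t) = \<bar>q t\<bar> * dist (v t) (w t)"
          by (simp add: dist_norm flip: scaleR_diff_right)
        also have "\<dots> \<le> M * dist v w"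
          using q(2) \<open>t \<in> {0..1}\<close> \<open>M \<ge> 0\<close> by (intro mult_mono dist_bounded) auto
        finally show "norm (?d v t - ?d w t) \<le> M * dist v w" .
      qed (use k r in auto)
      also have "\<dots> = (M / k) * dist v w" by simp
      also have "\<dots> \<le> 1/2 * dist v w" using k by (intro mult_right_mono) (auto simp: field_simps)
      finally show "dist (apply_bcontfun (T v) x) (apply_bcontfun (T w) x) \<le> 1/2 * dist v w"
        by (simp add: T dist_norm)
    qed
  qed
  then obtain w where "T w = w" by blast
  then have "w x = V w x" if "x \<in> {0..1}" for x
    using T[of w x] r(3)[OF that] by simp
  then show thesis using that[OF wc[of w]] by (simp add: V_def)
qed

text \<open>A priori bound for the inhomogeneous Volterra equation, by evaluation at a maximum of the norm.\<close>

lemma volterra_solution_bound: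
  fixes r f :: "real \<Rightarrow> 'a::euclidean_space" and q :: "real \<Rightarrow> real"
  assumes q: "\<And>x. x \<in> {0..1} \<Longrightarrow> \<bar>q x\<bar> \<le> M" and k: "k > 0" "2 * M \<le> k"
    and r: "continuous_on {0..1} r"
    and eq: "\<And>x. x \<in> {0..1} \<Longrightarrow> r x = sine_volterra k (\<lambda>t. q t *\<^sub>R r t - f t) x"
    and int: "\<And>x. x \<in> {0..1} \<Longrightarrow>
        (\<lambda>t. sin (k * (x - t)) *\<^sub>R (q t *\<^sub>R r t - f t)) integrable_on {0..x}"
    and f: "(\<lambda>t. norm (f t)) integrable_on {0..1}"
    and x: "x \<in> {0..1}"
  shows "norm (r x) \<le> 2 * integral {0..1} (\<lambda>t. norm (f t)) / k"
proof -
  have "continuous_on {0..1} (\<lambda>x. norm (r x))" by (intro continuous_intros r)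
  then obtain x0 where x0: "x0 \<in> {0..1}" "\<And>y. y \<in> {0..1} \<Longrightarrow> norm (r y) \<le> norm (r x0)"
    using continuous_attains_sup[of "{0..1::real}"] by (metis atLeastAtMost_iff compact_Icc empty_iff order_refl zero_le_one)
  have "M \<ge> 0" using q[of 0] by auto
  have "norm (r x0) = norm (sine_volterra k (\<lambda>t. q t *\<^sub>R r t - f t) x0)" using eq[OF x0(1)] by simp
  also have "\<dots> \<le> integral {0..1} (\<lambda>t. M * norm (r x0) + norm (f t)) / k"
  proof (rule norm_sine_volterra_le[OF int])
    fix t :: real assume t: "t \<in> {0..1}"
    have "norm (q t *\<^sub>R r t - f t) \<le> \<bar>q t\<bar> * norm (r t) + norm (f t)"
      by (metis norm_scaleR norm_triangle_ineq4)
    also have "\<dots> \<le> M * norm (r x0) + norm (f t)"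
      using q[OF t] x0(2)[OF t] \<open>M \<ge> 0\<close> by (intro add_mono mult_mono) auto
    finally show "norm (q t *\<^sub>R r t - f t) \<le> M * norm (r x0) + norm (f t)" .
  qed (use f k x0 in \<open>auto intro!: integrable_add\<close>)
  also have "\<dots> = (M / k) * norm (r x0) + integral {0..1} (\<lambda>t. norm (f t)) / k"
    using f by (subst integral_add) (auto simp: add_divide_distrib)
  also have "(M / k) * norm (r x0) \<le> 1/2 * norm (r x0)"
    using k by (intro mult_right_mono) (auto simp: field_simps)
  finally have "norm (r x0) \<le> 2 * integral {0..1} (\<lambda>t. norm (f t)) / k" by simp
  then show ?thesis using x0(2)[OF x] by simp
qed

section \<open>Functions with absolutely continuous derivative\<close>

lemma AE_open_unit_intervalD:
  assumes "AE x in lebesgue_on {0<..<1::real}. P x"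
  obtains N where "negligible N" "\<And>x. x \<in> {0..1} - N \<Longrightarrow> P x"
proof -
  have "AE x in lebesgue. x \<in> {0<..<1} \<longrightarrow> P x"
    using assms by (subst (asm) AE_restrict_space_iff) auto
  then obtain N where N: "N \<in> null_sets lebesgue" "{x. \<not> (x \<in> {0<..<1} \<longrightarrow> P x)} \<subseteq> N"
    by (auto simp: eventually_ae_filter)
  show thesis
  proof (rule that[of "insert 0 (insert 1 N)"])
    show "negligible (insert 0 (insert 1 N))"
      using N(1) by (simp add: negligible_iff_null_sets[symmetric] negligible_insert)
    show "P x" if "x \<in> {0..1} - insert 0 (insert 1 N)" for x
    proof -
      have "x \<in> {0<..<1}" "x \<notin> N" using that by auto
      then show ?thesis using N(2) by blast
    qed
  qed
qed

lemma AE_closed_unit_intervalD: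
  assumes "AE x in lebesgue_on {0..1::real}. P x"
  obtains N where "negligible N" "\<And>x. x \<in> {0..1} - N \<Longrightarrow> P x"
proof -
  have "AE x in lebesgue. x \<in> {0..1} \<longrightarrow> P x"
    using assms by (subst (asm) AE_restrict_space_iff) auto
  then obtain N where N: "N \<in> null_sets lebesgue" "{x. \<not> (x \<in> {0..1} \<longrightarrow> P x)} \<subseteq> N"
    by (auto simp: eventually_ae_filter)
  show thesis
    by (rule that[of N]) (use N in \<open>auto simp: negligible_iff_null_sets\<close>)
qed

lemma AE_unit_intervalI:
  assumes N: "negligible N" and P: "\<And>x. x \<in> {0..1::real} - N \<Longrightarrow> P x"
  shows "AE x in lebesgue_on {0<..<1}. P x" "AE x in lebesgue_on {0..1}. P x"
proof -
  have "AE x in lebesgue. x \<notin> N"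
    using N by (intro AE_not_in) (simp add: negligible_iff_null_sets)
  then show "AE x in lebesgue_on {0<..<1}. P x" "AE x in lebesgue_on {0..1}. P x"
    using P by (auto simp: AE_restrict_space_iff elim!: eventually_mono)
qed

lemma deriv01_eq:
  assumes "x \<in> {0..1}" "(y has_vector_derivative d) (at x within {0..1})"
  shows "deriv01 y x = d"
  unfolding deriv01_def
  using vector_derivative_within_cbox[of 0 1 x y d] assms by simp

lemma twice_AC_imp:
  fixes y :: "real \<Rightarrow> 'a::euclidean_space"
  assumes "twice_AC y"
  shows "\<And>x. x \<in> {0..1} \<Longrightarrow> (y has_vector_derivative deriv01 y x) (at x within {0..1})"
    and "absolutely_continuous_on_interval 0 1 (deriv01 y)"
    and "\<exists>N. negligible N \<and> (\<forall>x\<in>{0..1} - N.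
           (deriv01 y has_vector_derivative deriv01 (deriv01 y) x) (at x within {0..1}))"
proof -
  show "(y has_vector_derivative deriv01 y x) (at x within {0..1})" if "x \<in> {0..1}" for x
    using assms that unfolding twice_AC_def deriv01_def differentiable_on_def
    by (simp add: vector_derivative_works)
  show "absolutely_continuous_on_interval 0 1 (deriv01 y)"
    using assms by (simp add: twice_AC_def)
  have "AE x in lebesgue_on {0..1}. deriv01 y differentiable (at x within {0..1})"
    using assms by (simp add: twice_AC_def)
  then obtain N where N: "negligible N"
      "\<And>x. x \<in> {0..1} - N \<Longrightarrow> deriv01 y differentiable (at x within {0..1})"
    by (rule AE_closed_unit_intervalD) blast
  then show "\<exists>N. negligible N \<and> (\<forall>x\<in>{0..1} - N.
           (deriv01 y has_vector_derivative deriv01 (deriv01 y) x) (at x within {0..1}))"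
    by (intro exI[of _ N]) (auto simp: deriv01_def[of "deriv01 y"] vector_derivative_works)
qed

lemma twice_ACI:
  fixes y :: "real \<Rightarrow> 'a::euclidean_space"
  assumes y: "\<And>x. x \<in> {0..1} \<Longrightarrow> (y has_vector_derivative y1 x) (at x within {0..1})"
    and ac: "absolutely_continuous_on_interval 0 1 y1"
    and N: "negligible N"
    and y1: "\<And>x. x \<in> {0..1} - N \<Longrightarrow> (y1 has_vector_derivative y2 x) (at x within {0..1})"
  shows "twice_AC y" "\<And>x. x \<in> {0..1} - N \<Longrightarrow> deriv01 (deriv01 y) x = y2 x"
proof -
  have eq: "deriv01 y x = y1 x" if "x \<in> {0..1}" for x
    using deriv01_eq[OF that y[OF that]] .
  have d: "(deriv01 y has_vector_derivative y2 x) (at x within {0..1})" if "x \<in> {0..1} - N" for x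
    using y1[OF that] that by (intro has_vector_derivative_transform[of x _ "deriv01 y" y1]) (auto simp: eq)
  show "deriv01 (deriv01 y) x = y2 x" if "x \<in> {0..1} - N" for x
    using deriv01_eq[OF _ d[OF that]] that by simp
  have "y differentiable_on {0..1}"
    unfolding differentiable_on_def using y differentiableI_vector by blast
  moreover have "absolutely_continuous_on_interval 0 1 y"
    by (rule AC_C1[OF y AC_imp_continuous_on[OF ac]])
  moreover have "absolutely_continuous_on_interval 0 1 (deriv01 y)"
    by (rule AC_cong[OF ac]) (simp add: eq)
  moreover have "AE x in lebesgue_on {0..1}. deriv01 y differentiable (at x within {0..1})"
    using N d differentiableI_vector by (intro AE_unit_intervalI) blast+
  ultimately show "twice_AC y" by (simp add: twice_AC_def)
qed

section \<open>Square integrable functions on the unit interval\<close>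

lemma integrable_const_unit: "integrable (lebesgue_on {0<..<1::real}) (\<lambda>x. c::'a::euclidean_space)"
proof -
  have "finite_measure (lebesgue_on {0<..<1::real})"
    by (rule finite_measure_lebesgue_on) auto
  then show ?thesis by (rule finite_measure.integrable_const)
qed

lemma L2_integrable:
  assumes "f \<in> L2"
  shows "integrable (lebesgue_on {0<..<1}) f"
proof (rule Bochner_Integration.integrable_bound)
  show "integrable (lebesgue_on {0<..<1}) (\<lambda>x. 1 + (cmod (f x))\<^sup>2)"
    using assms by (intro Bochner_Integration.integrable_add integrable_const_unit) (auto simp: L2_def)
  have "cmod z \<le> 1 + (cmod z)\<^sup>2" for z
    using sum_squares_ge_zero[of "cmod z - 1" 0] norm_ge_zero[of z]
    by (simp add: power2_eq_square left_diff_distrib right_diff_distrib) (use norm_ge_zero[of z] in linarith)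
  then show "AE x in lebesgue_on {0<..<1}. norm (f x) \<le> norm (1 + (cmod (f x))\<^sup>2)"
    by (intro AE_I2) (simp add: order_trans[OF _ abs_ge_self])
qed (use assms in \<open>auto simp: L2_def\<close>)

lemma L2_absolutely_integrable:
  assumes "f \<in> L2"
  shows "f absolutely_integrable_on {0..1}"
proof -
  have "f absolutely_integrable_on {0<..<1}"
    using L2_integrable[OF assms] by (simp add: set_integrable_def integrable_restrict_space)
  then show ?thesis by (simp add: absolutely_integrable_on_Icc_iff_Ioo)
qed

lemma L2_norm_nonneg: "L2_norm f \<ge> 0"
  by (simp add: L2_norm_def)

text \<open>The Cauchy-Schwarz inequality against the constant 1, from \<open>2s|f| \<le> |f|\<^sup>2 + s\<^sup>2\<close>.\<close>

lemma L1_norm_le_L2_norm: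
  assumes f: "f \<in> L2"
  shows "integral {0..1} (\<lambda>x. cmod (f x)) \<le> L2_norm f"
proof (rule dense_le)
  fix t assume t: "t < integral {0..1} (\<lambda>x. cmod (f x))"
  let ?M = "lebesgue_on {0<..<1::real}"
  have eq: "integral {0..1} (\<lambda>x. cmod (f x)) = (LINT x|?M. cmod (f x))"
    using L2_integrable[OF f]
    by (subst lebesgue_integral_eq_integral) (auto simp: integral_open_interval_real)
  have le: "(LINT x|?M. cmod (f x)) \<le> s" if s: "L2_norm f < s" for s
  proof -
    have "s > 0" using s L2_norm_nonneg[of f] by simp
    have sq: "integrable ?M (\<lambda>x. (cmod (f x))\<^sup>2)" using f by (simp add: L2_def)
    have N: "(LINT x|?M. (cmod (f x))\<^sup>2) = (L2_norm f)\<^sup>2"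
      by (simp add: L2_norm_def)
    have "(LINT x|?M. cmod (f x)) \<le> (LINT x|?M. (cmod (f x))\<^sup>2 / (2 * s) + s / 2)"
    proof (rule integral_mono)
      show "integrable ?M (\<lambda>x. cmod (f x))" using L2_integrable[OF f] by simp
      show "integrable ?M (\<lambda>x. (cmod (f x))\<^sup>2 / (2 * s) + s / 2)"
        using sq by (intro Bochner_Integration.integrable_add integrable_const_unit) auto
      show "cmod (f x) \<le> (cmod (f x))\<^sup>2 / (2 * s) + s / 2" for x
        using \<open>s > 0\<close> sum_squares_ge_zero[of "cmod (f x) - s" 0]
        by (simp add: field_simps power2_eq_square)
    qed
    also have "\<dots> = (L2_norm f)\<^sup>2 / (2 * s) + s / 2"
      using sq by (subst Bochner_Integration.integral_add)
        (auto simp: N integrable_const_unit measure_restrict_space)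
    also have "\<dots> \<le> s\<^sup>2 / (2 * s) + s / 2"
      using s \<open>s > 0\<close> L2_norm_nonneg[of f] by (intro add_right_mono divide_right_mono power_mono) auto
    also have "\<dots> = s" using \<open>s > 0\<close> by (simp add: power2_eq_square)
    finally show ?thesis .
  qed
  show "t \<le> L2_norm f"
  proof (rule ccontr)
    assume "\<not> t \<le> L2_norm f"
    then show False using le[of t] t eq by simp
  qed
qed

lemma L2_add_scaled:
  assumes "f \<in> L2" "g \<in> L2"
  shows "(\<lambda>x. f x + c * g x) \<in> L2"
proof -
  let ?M = "lebesgue_on {0<..<1::real}"
  have [measurable]: "f \<in> borel_measurable ?M" "g \<in> borel_measurable ?M"
    using assms by (auto simp: L2_def)
  have "integrable ?M (\<lambda>x. (cmod (f x + c * g x))\<^sup>2)"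
  proof (rule Bochner_Integration.integrable_bound)
    show "integrable ?M (\<lambda>x. 2 * (cmod (f x))\<^sup>2 + (2 * (cmod c)\<^sup>2) * (cmod (g x))\<^sup>2)"
      using assms by (intro Bochner_Integration.integrable_add integrable_mult_right) (auto simp: L2_def)
    have "(cmod (a + c * b))\<^sup>2 \<le> 2 * (cmod a)\<^sup>2 + (2 * (cmod c)\<^sup>2) * (cmod b)\<^sup>2" for a b
    proof -
      have "(cmod (a + c * b))\<^sup>2 \<le> (cmod a + cmod (c * b))\<^sup>2"
        by (intro power_mono norm_triangle_ineq) auto
      also have "\<dots> \<le> 2 * (cmod a)\<^sup>2 + 2 * (cmod (c * b))\<^sup>2"
        using sum_squares_ge_zero[of "cmod a - cmod (c * b)" 0]
        by (simp add: power2_eq_square algebra_simps)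
      finally show ?thesis by (simp add: norm_mult power_mult_distrib)
    qed
    then show "AE x in ?M. norm ((cmod (f x + c * g x))\<^sup>2)
        \<le> norm (2 * (cmod (f x))\<^sup>2 + (2 * (cmod c)\<^sup>2) * (cmod (g x))\<^sup>2)"
      by (intro AE_I2) (simp add: order_trans[OF _ abs_ge_self])
  qed measurable
  then show ?thesis by (auto simp: L2_def)
qed

lemma continuous_on_imp_L2:
  assumes y: "continuous_on {0..1} y" and D: "\<And>x. x \<in> {0..1} \<Longrightarrow> cmod (y x) \<le> D"
  shows "y \<in> L2" "L2_norm y \<le> D"
proof -
  let ?M = "lebesgue_on {0<..<1::real}"
  have m: "y \<in> borel_measurable ?M"
    using y by (intro continuous_imp_measurable_on_sets_lebesgue) (auto elim: continuous_on_subset)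
  have "D \<ge> 0" using order_trans[OF norm_ge_zero D[of 0]] by simp
  have le: "(cmod (y x))\<^sup>2 \<le> D\<^sup>2" if "x \<in> space ?M" for x
    using D[of x] that by (intro power_mono) auto
  have int: "integrable ?M (\<lambda>x. (cmod (y x))\<^sup>2)"
    using m le by (intro Bochner_Integration.integrable_bound[OF integrable_const_unit[of "D\<^sup>2"]] AE_I2) auto
  show "y \<in> L2" using m int by (simp add: L2_def)
  have "(LINT x|?M. (cmod (y x))\<^sup>2) \<le> (LINT x|?M. D\<^sup>2)"
    using le by (intro integral_mono int integrable_const_unit) auto
  also have "\<dots> = D\<^sup>2" by (simp add: measure_restrict_space)
  finally show "L2_norm y \<le> D"
    unfolding L2_norm_def using \<open>D \<ge> 0\<close> real_le_lsqrt by blast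
qed

lemma L2_norm_cong_AE:
  assumes "u \<in> L2" "y \<in> L2" "u \<doteq> y"
  shows "L2_norm u = L2_norm y"
proof -
  have "(LINT x|lebesgue_on {0<..<1}. (cmod (u x))\<^sup>2) = (LINT x|lebesgue_on {0<..<1}. (cmod (y x))\<^sup>2)"
  proof (rule integral_cong_AE)
    show "AE x in lebesgue_on {0<..<1}. (cmod (u x))\<^sup>2 = (cmod (y x))\<^sup>2"
      using assms(3) by (auto simp: ae_eq_def)
  qed (use assms in \<open>auto simp: L2_def\<close>)
  then show ?thesis by (simp add: L2_norm_def)
qed

section \<open>Solutions of the eigenvalue equation\<close>

text \<open>Variation of constants: a solution of \<open>y'' = (q - k\<^sup>2) y - f\<close> almost everywhere, with \<open>y(0) = 0\<close>
  and \<open>y'\<close> absolutely continuous, solves a Volterra equation.\<close>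

lemma variation_of_constants:
  fixes y y1 f :: "real \<Rightarrow> 'a::euclidean_space" and q :: "real \<Rightarrow> real"
  assumes y: "\<And>x. x \<in> {0..1} \<Longrightarrow> (y has_vector_derivative y1 x) (at x within {0..1})"
    and ac: "absolutely_continuous_on_interval 0 1 y1"
    and N: "negligible N"
    and y1: "\<And>x. x \<in> {0..1} - N \<Longrightarrow>
        (y1 has_vector_derivative (q x - k\<^sup>2) *\<^sub>R y x - f x) (at x within {0..1})"
    and y0: "y 0 = 0" and x: "x \<in> {0..1}"
  shows "((\<lambda>t. sin (k * (x - t)) *\<^sub>R (q t *\<^sub>R y t - f t)) has_integral
            k *\<^sub>R y x - sin (k * x) *\<^sub>R y1 0) {0..x}"
proof -
  \<comment> \<open>\<open>G\<close> is the Wronskian type expression with \<open>G(x) = k y(x)\<close> whose derivative eliminates \<open>y'\<close>\<close>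
  define G where "G = (\<lambda>t. sin (k * (x - t)) *\<^sub>R y1 t + (k * cos (k * (x - t))) *\<^sub>R y t)"
  have s: "((\<lambda>t. sin (k * (x - t))) has_real_derivative - (k * cos (k * (x - t)))) (at t within S)"
    and c: "((\<lambda>t. k * cos (k * (x - t))) has_real_derivative k * (k * sin (k * (x - t)))) (at t within S)" for t S
    by (auto intro!: derivative_eq_intros)
  have acs: "absolutely_continuous_on_interval 0 1 (\<lambda>t. sin (k * (x - t)))"
    "absolutely_continuous_on_interval 0 1 (\<lambda>t. k * cos (k * (x - t)))"
    by (rule AC_C1[OF s[unfolded has_real_derivative_iff_has_vector_derivative]], intro continuous_intros)
      (rule AC_C1[OF c[unfolded has_real_derivative_iff_has_vector_derivative]], intro continuous_intros)
  have "absolutely_continuous_on_interval 0 1 G"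
    unfolding G_def by (intro AC_add AC_scaleR acs ac AC_C1[OF y AC_imp_continuous_on[OF ac]])
  then have acG: "absolutely_continuous_on_interval 0 x G"
    by (rule AC_subinterval) (use x in auto)
  have "((\<lambda>t. sin (k * (x - t)) *\<^sub>R (q t *\<^sub>R y t - f t)) has_integral G x - G 0) {0..x}"
  proof (rule AC_fundamental_theorem_of_calculus[OF acG _ N])
    fix t assume t: "t \<in> {0..x} - N"
    then have t1: "t \<in> {0..1} - N" using x by auto
    have "(G has_vector_derivative sin (k * (x - t)) *\<^sub>R (q t *\<^sub>R y t - f t)) (at t within {0..1})"
      unfolding G_def
      by (rule has_vector_derivative_eq_rhs[OF has_vector_derivative_add[OF
              has_vector_derivative_scaleR[OF s y1[OF t1]] has_vector_derivative_scaleR[OF c y]]])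
        (use t1 in \<open>auto simp: algebra_simps power2_eq_square\<close>)
    then show "(G has_vector_derivative sin (k * (x - t)) *\<^sub>R (q t *\<^sub>R y t - f t)) (at t within {0..x})"
      by (rule has_vector_derivative_within_subset) (use x in auto)
  qed (use x in auto)
  then show ?thesis by (simp add: G_def y0)
qed

text \<open>For large \<open>k\<close> the solution of \<open>y'' = (q - k\<^sup>2) y\<close> with \<open>y(0) = 0\<close>, \<open>y'(0) = k\<close> is uniformly
  close to \<open>sin kx\<close>.\<close>

lemma dirichlet_solution_near_sine:
  fixes q :: "real \<Rightarrow> real"
  assumes q: "continuous_on {0..1} q" "\<And>x. x \<in> {0..1} \<Longrightarrow> \<bar>q x\<bar> \<le> M" and k: "k > 0" "2 * M \<le> k"
  obtains \<phi> \<phi>1 where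
    "\<And>x. x \<in> {0..1} \<Longrightarrow> (\<phi> has_vector_derivative \<phi>1 x) (at x within {0..1})"
    "\<And>x. x \<in> {0..1} \<Longrightarrow> (\<phi>1 has_vector_derivative (q x - k\<^sup>2) * \<phi> x) (at x within {0..1})"
    "\<phi> 0 = 0" "\<phi>1 0 = k" "\<And>x. x \<in> {0..1} \<Longrightarrow> \<bar>\<phi> x - sin (k * x)\<bar> \<le> 2 * M / k"
proof -
  obtain w where w: "continuous_on {0..1} w"
    "\<And>x. x \<in> {0..1} \<Longrightarrow> w x = sin (k * x) + sine_volterra k (\<lambda>t. q t *\<^sub>R w t) x"
    by (rule volterra_equation_solvable[OF q k, of "\<lambda>x. sin (k * x)"])
      (assumption, intro continuous_intros, blast)
  let ?h = "\<lambda>t. q t *\<^sub>R w t"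
  have h: "continuous_on {0..1} ?h" by (intro continuous_intros q w)
  have k0: "k \<noteq> 0" using k by simp
  define \<phi> where "\<phi> = (\<lambda>x. sin (k * x) + sine_volterra k ?h x)"
  define \<phi>1 where "\<phi>1 = (\<lambda>x. k * cos (k * x) + cosine_volterra k ?h x)"
  have w\<phi>: "w x = \<phi> x" if "x \<in> {0..1}" for x using w(2)[OF that] by (simp add: \<phi>_def)
  have s: "((\<lambda>x. sin (k * x)) has_vector_derivative k * cos (k * x)) (at x within {0..1})"
    and c: "((\<lambda>x. k * cos (k * x)) has_vector_derivative - (k\<^sup>2 * sin (k * x))) (at x within {0..1})" for x
    by (auto intro!: derivative_eq_intros simp: power2_eq_square
        simp flip: has_real_derivative_iff_has_vector_derivative)
  have "M \<ge> 0" using q(2)[of 0] by auto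
  show thesis
  proof (rule that)
    fix x :: real assume x: "x \<in> {0..1}"
    show "(\<phi> has_vector_derivative \<phi>1 x) (at x within {0..1})"
      unfolding \<phi>_def \<phi>1_def
      by (rule has_vector_derivative_add[OF s sine_volterra_has_derivative[OF h k0 x]])
    show "(\<phi>1 has_vector_derivative (q x - k\<^sup>2) * \<phi> x) (at x within {0..1})"
      unfolding \<phi>1_def
      by (rule has_vector_derivative_eq_rhs[OF
            has_vector_derivative_add[OF c cosine_volterra_has_derivative[OF h k0 x]]])
        (simp add: w\<phi>[OF x], simp add: \<phi>_def algebra_simps)
    \<comment> \<open>the deviation from the sine satisfies \<open>r'' = (q - k\<^sup>2) r - f\<close> with \<open>f = - q sin kx\<close>\<close>
    define r where "r = (\<lambda>x. w x - sin (k * x))"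
    have r: "continuous_on {0..1} r" unfolding r_def by (intro continuous_intros w)
    have req: "q t *\<^sub>R r t - - (q t * sin (k * t)) = q t *\<^sub>R w t" for t by (simp add: r_def algebra_simps)
    have fi: "(\<lambda>t. norm (- (q t * sin (k * t)))) integrable_on {0..1}"
      by (intro integrable_continuous_real continuous_intros q)
    have "norm (r x) \<le> 2 * integral {0..1} (\<lambda>t. norm (- (q t * sin (k * t)))) / k"
    proof (rule volterra_solution_bound[where f = "\<lambda>t. - (q t * sin (k * t))", OF q(2) k r _ _ fi x])
      fix x :: real assume x: "x \<in> {0..1}"
      show "r x = sine_volterra k (\<lambda>t. q t *\<^sub>R r t - - (q t * sin (k * t))) x"
        unfolding req using w(2)[OF x] by (simp add: r_def)
      show "(\<lambda>t. sin (k * (x - t)) *\<^sub>R (q t *\<^sub>R r t - - (q t * sin (k * t)))) integrable_on {0..x}"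
        unfolding req by (rule sine_volterra_integrand_continuous[OF h x])
    qed
    also have "integral {0..1} (\<lambda>t. norm (- (q t * sin (k * t)))) \<le> integral {0..1} (\<lambda>t::real. M)"
    proof (rule integral_le[OF fi])
      fix t :: real assume "t \<in> {0..1}"
      then have "\<bar>q t\<bar> * \<bar>sin (k * t)\<bar> \<le> M * 1" using q(2) \<open>M \<ge> 0\<close> by (intro mult_mono) auto
      then show "norm (- (q t * sin (k * t))) \<le> M" by (simp add: abs_mult)
    qed auto
    finally show "\<bar>\<phi> x - sin (k * x)\<bar> \<le> 2 * M / k"
      using k(1) by (simp add: r_def w\<phi>[OF x] divide_right_mono)
  qed (simp_all add: \<phi>_def \<phi>1_def sine_volterra_def cosine_volterra_def)
qed

section \<open>The resolvent of the Dirichlet operator\<close>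

text \<open>If the solution of the initial value problem does not vanish at 1, then \<open>k\<^sup>2\<close> is in the resolvent set.
  The bound for the inverse comes from \<open>y = r + c \<phi>\<close>, where \<open>r\<close> solves the initial value problem with
  \<open>r(0) = r'(0) = 0\<close> and \<open>c\<close> is determined by \<open>y(1) = 0\<close>. For surjectivity, the twofold
  primitive \<open>F2\<close> of the right-hand side is split off, so that \<open>y + F2\<close> solves an equation with a continuous
  right-hand side.\<close>

theorem resolvent_set_dirichlet_operator:
  fixes q :: "real \<Rightarrow> real"
  assumes q: "continuous_on {0..1} q" "\<And>x. x \<in> {0..1} \<Longrightarrow> \<bar>q x\<bar> \<le> M" and k: "k > 0" "2 * M \<le> k"
    and \<phi>: "\<And>x. x \<in> {0..1} \<Longrightarrow> (\<phi> has_vector_derivative \<phi>1 x) (at x within {0..1})"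
    and \<phi>1: "\<And>x. x \<in> {0..1} \<Longrightarrow> (\<phi>1 has_vector_derivative (q x - k\<^sup>2) * \<phi> x) (at x within {0..1})"
    and \<phi>0: "\<phi> 0 = 0" "\<phi>1 0 = k" and nz: "\<phi> 1 \<noteq> (0::real)"
  shows "complex_of_real (k\<^sup>2) \<in> resolvent_set (dirichlet_operator q)"
proof -
  let ?\<mu> = "complex_of_real (k\<^sup>2)"
  have k0: "k \<noteq> 0" using k by simp
  have c\<phi>: "continuous_on {0..1} \<phi>"
    using \<phi> by (rule continuous_on_vector_derivative)
  have ac\<phi>1: "absolutely_continuous_on_interval 0 1 \<phi>1"
    by (rule AC_C1[OF \<phi>1]) (auto intro!: continuous_intros q c\<phi>)
  have "bounded (\<phi> ` {0..1})" using c\<phi> by (simp add: compact_continuous_image compact_imp_bounded)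
  then obtain P where P: "\<And>x. x \<in> {0..1} \<Longrightarrow> \<bar>\<phi> x\<bar> \<le> P" by (metis bounded_iff image_eqI real_norm_def)

  have dc: "((\<lambda>x. g x *\<^sub>R c) has_vector_derivative g' *\<^sub>R c) (at x within S)"
    if "(g has_vector_derivative g') (at x within S)" for g g' x S and c :: complex
    using bounded_linear.has_vector_derivative[OF bounded_linear_scaleR_left that] .
  define C where "C = 2 / k + P * (2 / (k * \<bar>\<phi> 1\<bar>))"
  have bound: "L2_norm u \<le> C * L2_norm (\<lambda>x. v x - ?\<mu> * u x)" if uv: "(u, v) \<in> dirichlet_operator q" for u v
  proof -
    obtain y where y: "u \<in> L2" "v \<in> L2" "twice_AC y" "y 0 = 0" "y 1 = 0" "u \<doteq> y"
        "v \<doteq> (\<lambda>x. - deriv01 (deriv01 y) x + of_real (q x) * y x)"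
      using uv by (auto simp: dirichlet_operator_def)
    define f where "f = (\<lambda>x. v x - ?\<mu> * u x)"
    have fL2: "f \<in> L2" using L2_add_scaled[OF y(2) y(1), of "- ?\<mu>"] by (simp add: f_def)
    have "AE x in lebesgue_on {0<..<1}. f x = - deriv01 (deriv01 y) x + of_real (q x) * y x - ?\<mu> * y x"
      using y(6,7) unfolding ae_eq_def f_def by eventually_elim simp
    then obtain N1 where N1: "negligible N1" "\<And>x. x \<in> {0..1} - N1 \<Longrightarrow>
        f x = - deriv01 (deriv01 y) x + of_real (q x) * y x - ?\<mu> * y x"
      by (rule AE_open_unit_intervalD) blast
    note yd = twice_AC_imp(1)[OF y(3)]
    obtain N2 where N2: "negligible N2" "\<And>x. x \<in> {0..1} - N2 \<Longrightarrow>
           (deriv01 y has_vector_derivative deriv01 (deriv01 y) x) (at x within {0..1})"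
      using twice_AC_imp(3)[OF y(3)] by blast
    \<comment> \<open>subtracting \<open>c \<phi>\<close> makes the initial slope vanish, so that the a priori bound applies to \<open>r\<close>\<close>
    define c where "c = deriv01 y 0 /\<^sub>R k"
    define r where "r = (\<lambda>x. y x - \<phi> x *\<^sub>R c)"
    define r1 where "r1 = (\<lambda>x. deriv01 y x - \<phi>1 x *\<^sub>R c)"
    have rd: "(r has_vector_derivative r1 x) (at x within {0..1})" if "x \<in> {0..1}" for x
      unfolding r_def r1_def by (intro has_vector_derivative_diff yd dc \<phi> that)
    have acr1: "absolutely_continuous_on_interval 0 1 r1"
      unfolding r1_def by (intro AC_diff twice_AC_imp(2)[OF y(3)] AC_scaleR ac\<phi>1 AC_lipschitz[of _ _ _ 0]) simp
    have r0: "r 0 = 0" "r1 0 = 0" using k0 by (simp_all add: r_def r1_def y(4) \<phi>0 c_def)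
    have r1d: "(r1 has_vector_derivative (q x - k\<^sup>2) *\<^sub>R r x - f x) (at x within {0..1})"
      if x: "x \<in> {0..1} - (N1 \<union> N2)" for x
      unfolding r1_def
      by (rule has_vector_derivative_eq_rhs[OF has_vector_derivative_diff[OF N2(2) dc[OF \<phi>1]]])
        (use x in \<open>auto simp: N1(2) r_def scaleR_conv_of_real algebra_simps\<close>)
    have hi: "((\<lambda>t. sin (k * (x - t)) *\<^sub>R (q t *\<^sub>R r t - f t)) has_integral k *\<^sub>R r x) {0..x}"
      if "x \<in> {0..1}" for x
      using variation_of_constants[OF rd acr1 negligible_Un[OF N1(1) N2(1)] r1d r0(1) that] r0(2) by simp
    define F where "F = integral {0..1} (\<lambda>x. cmod (f x))"
    have rb: "cmod (r x) \<le> 2 * F / k" if "x \<in> {0..1}" for x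
      unfolding F_def
    proof (rule volterra_solution_bound[OF q(2) k _ _ _ _ that])
      show "continuous_on {0..1} r" using rd by (rule continuous_on_vector_derivative)
      show "(\<lambda>t. cmod (f t)) integrable_on {0..1}"
        using absolutely_integrable_norm[OF L2_absolutely_integrable[OF fL2]]
        by (simp add: comp_def set_lebesgue_integral_eq_integral)
      show "r x = sine_volterra k (\<lambda>t. q t *\<^sub>R r t - f t) x" if "x \<in> {0..1}" for x
        using integral_unique[OF hi[OF that]] k0 by (simp add: sine_volterra_def)
      show "(\<lambda>t. sin (k * (x - t)) *\<^sub>R (q t *\<^sub>R r t - f t)) integrable_on {0..x}" if "x \<in> {0..1}" for x
        using hi[OF that] by blast
    qed
    have "\<phi> 1 *\<^sub>R c = - r 1" using y(5) by (simp add: r_def)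
    then have "\<bar>\<phi> 1\<bar> * cmod c = cmod (r 1)" by (metis norm_minus_cancel norm_scaleR)
    then have "\<bar>\<phi> 1\<bar> * cmod c \<le> 2 * F / k" using rb[of 1] by simp
    then have cb: "cmod c \<le> (2 / (k * \<bar>\<phi> 1\<bar>)) * F"
      using nz k(1) by (simp add: field_simps)
    have yb: "cmod (y x) \<le> C * F" if x: "x \<in> {0..1}" for x
    proof -
      have "cmod (y x) = cmod (r x + \<phi> x *\<^sub>R c)" by (simp add: r_def)
      also have "\<dots> \<le> cmod (r x) + \<bar>\<phi> x\<bar> * cmod c" by (metis norm_scaleR norm_triangle_ineq)
      also have "\<dots> \<le> 2 * F / k + P * ((2 / (k * \<bar>\<phi> 1\<bar>)) * F)"
        using rb[OF x] P[OF x] cb by (intro add_mono mult_mono) auto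
      finally show ?thesis by (simp add: C_def algebra_simps)
    qed
    have cy: "continuous_on {0..1} y" using yd by (rule continuous_on_vector_derivative)
    have "P \<ge> 0" using P[of 0] by auto
    then have "C \<ge> 0" using k(1) by (simp add: C_def)
    have "L2_norm u = L2_norm y"
      by (rule L2_norm_cong_AE[OF y(1) continuous_on_imp_L2(1)[OF cy yb] y(6)])
    also have "\<dots> \<le> C * F" by (rule continuous_on_imp_L2(2)[OF cy yb])
    also have "\<dots> \<le> C * L2_norm f"
      unfolding F_def using L1_norm_le_L2_norm[OF fL2] \<open>C \<ge> 0\<close> by (intro mult_left_mono)
    finally show ?thesis by (simp add: f_def)
  qed
  have inj: "u \<doteq> (\<lambda>_. 0)" if uv: "(u, v) \<in> dirichlet_operator q" and z: "(\<lambda>x. v x - ?\<mu> * u x) \<doteq> (\<lambda>_. 0)" for u v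
  proof -
    have u: "u \<in> L2" and v: "v \<in> L2" using uv by (auto simp: dirichlet_operator_def)
    have vu: "(\<lambda>x. v x - ?\<mu> * u x) \<in> L2" using L2_add_scaled[OF v u, of "- ?\<mu>"] by simp
    have z0: "(\<lambda>_. 0) \<in> L2" by (simp add: L2_def)
    have "L2_norm (\<lambda>x. v x - ?\<mu> * u x) = 0"
      using L2_norm_cong_AE[OF vu z0 z] by (simp add: L2_norm_def)
    then have "L2_norm u \<le> 0" using bound[OF uv] by simp
    then have "L2_norm u = 0" using L2_norm_nonneg[of u] by simp
    then have "(LINT x|lebesgue_on {0<..<1}. (cmod (u x))\<^sup>2) = 0"
      by (simp add: L2_norm_def)
    then have "AE x in lebesgue_on {0<..<1}. (cmod (u x))\<^sup>2 = 0"
      using u by (subst (asm) integral_nonneg_eq_0_iff_AE) (auto simp: L2_def)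
    then show ?thesis by (simp add: ae_eq_def)
  qed
  have surj: "\<exists>(u, v)\<in>dirichlet_operator q. (\<lambda>x. v x - ?\<mu> * u x) \<doteq> f" if fL2: "f \<in> L2" for f
  proof -
    note fi = L2_absolutely_integrable[OF fL2]
    define F1 where "F1 = (\<lambda>x. integral {0..x} f)"
    define F2 where "F2 = (\<lambda>x. integral {0..x} F1)"
    have acF1: "absolutely_continuous_on_interval 0 1 F1"
      unfolding F1_def by (rule AC_indefinite_integral[OF fi])
    have F2d: "(F2 has_vector_derivative F1 x) (at x within {0..1})" if "x \<in> {0..1}" for x
      unfolding F2_def by (intro integral_has_vector_derivative AC_imp_continuous_on[OF acF1] that)
    have cF2: "continuous_on {0..1} F2" using F2d by (rule continuous_on_vector_derivative)
    obtain N where N: "negligible N" "\<And>x. x \<in> {0..1} - N \<Longrightarrow>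
        (F1 has_vector_derivative f x) (at x within {0..1})"
      unfolding F1_def
      by (rule indefinite_integral_has_vector_derivative_ae[of f 0 1])
        (use fi in \<open>auto simp: set_lebesgue_integral_eq_integral\<close>)
    \<comment> \<open>with \<open>y = w - F2 + c \<phi>\<close>, \<open>y'' = (q - k\<^sup>2) y - f\<close> amounts to \<open>w'' + k\<^sup>2 w = q w - (q - k\<^sup>2) F2\<close>\<close>
    define h0 where "h0 = (\<lambda>t. - ((q t - k\<^sup>2) *\<^sub>R F2 t))"
    have ch0: "continuous_on {0..1} h0" unfolding h0_def by (intro continuous_intros q cF2)
    obtain w where w: "continuous_on {0..1} w"
      "\<And>x. x \<in> {0..1} \<Longrightarrow> w x = sine_volterra k h0 x + sine_volterra k (\<lambda>t. q t *\<^sub>R w t) x"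
      using volterra_equation_solvable[OF q k continuous_on_sine_volterra(1)[OF ch0 k0]] by blast
    define h where "h = (\<lambda>t. h0 t + q t *\<^sub>R w t)"
    have cqw: "continuous_on {0..1} (\<lambda>t. q t *\<^sub>R w t)" by (intro continuous_intros q w)
    have ch: "continuous_on {0..1} h" unfolding h_def by (intro continuous_intros ch0 cqw)
    have wh: "sine_volterra k h x = w x" if x: "x \<in> {0..1}" for x
      unfolding w(2)[OF x] sine_volterra_def h_def scaleR_add_right
      using sine_volterra_integrand_continuous[OF ch0 x] sine_volterra_integrand_continuous[OF cqw x]
      by (subst integral_add) (simp_all add: scaleR_add_right)
    define c where "c = (F2 1 - w 1) /\<^sub>R \<phi> 1"
    define y where "y = (\<lambda>x. sine_volterra k h x - F2 x + \<phi> x *\<^sub>R c)"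
    define y1 where "y1 = (\<lambda>x. cosine_volterra k h x - F1 x + \<phi>1 x *\<^sub>R c)"
    define y2 where "y2 = (\<lambda>x. (q x - k\<^sup>2) *\<^sub>R y x - f x)"
    have yd: "(y has_vector_derivative y1 x) (at x within {0..1})" if "x \<in> {0..1}" for x
      unfolding y_def y1_def
      by (intro has_vector_derivative_add has_vector_derivative_diff dc \<phi> F2d
          sine_volterra_has_derivative[OF ch k0] that)
    have cv: "absolutely_continuous_on_interval 0 1 (cosine_volterra k h)"
      by (rule AC_C1[OF cosine_volterra_has_derivative[OF ch k0]])
        (auto intro!: continuous_intros ch continuous_on_sine_volterra[OF ch k0])
    have acy1: "absolutely_continuous_on_interval 0 1 y1"
      unfolding y1_def by (intro AC_add AC_diff cv acF1 AC_scaleR ac\<phi>1 AC_lipschitz[of _ _ _ 0]) simp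
    have y1d: "(y1 has_vector_derivative y2 x) (at x within {0..1})" if x: "x \<in> {0..1} - N" for x
    proof -
      have x01: "x \<in> {0..1}" using x by auto
      show ?thesis unfolding y1_def
        by (rule has_vector_derivative_eq_rhs[OF has_vector_derivative_add[OF has_vector_derivative_diff[OF
                cosine_volterra_has_derivative[OF ch k0 x01] N(2)[OF x]] dc[OF \<phi>1[OF x01]]]])
          (simp add: y2_def y_def wh[OF x01], simp add: h_def h0_def algebra_simps)
    qed
    note tw = twice_ACI[OF yd acy1 N(1) y1d]
    have "F2 0 = 0" "sine_volterra k h 0 = 0" by (simp_all add: F2_def sine_volterra_def)
    then have y0: "y 0 = 0" by (simp add: y_def \<phi>0)
    have y1: "y 1 = 0" using nz by (simp add: y_def wh c_def)
    have cy: "continuous_on {0..1} y" using yd by (rule continuous_on_vector_derivative)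
    then have "bounded (y ` {0..1})" by (simp add: compact_continuous_image compact_imp_bounded)
    then obtain D where D: "\<And>x. x \<in> {0..1} \<Longrightarrow> cmod (y x) \<le> D" by (metis bounded_iff image_eqI)
    have yL2: "y \<in> L2" by (rule continuous_on_imp_L2(1)[OF cy D])
    define v where "v = (\<lambda>x. f x + ?\<mu> * y x)"
    have vL2: "v \<in> L2" unfolding v_def by (rule L2_add_scaled[OF fL2 yL2])
    have "v \<doteq> (\<lambda>x. - deriv01 (deriv01 y) x + of_real (q x) * y x)"
      unfolding ae_eq_def
      using tw(2) by (intro AE_unit_intervalI[OF N(1)])
        (simp add: y2_def v_def scaleR_conv_of_real algebra_simps)
    then have "(y, v) \<in> dirichlet_operator q"
      using yL2 vL2 tw(1) y0 y1 by (auto simp: dirichlet_operator_def ae_eq_def intro!: exI[of _ y])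
    moreover have "(\<lambda>x. v x - ?\<mu> * y x) \<doteq> f" by (simp add: v_def ae_eq_def)
    ultimately show ?thesis by blast
  qed
  show ?thesis
    unfolding resolvent_set_def using surj inj bound by blast
qed

section \<open>Moments against squares of sines\<close>

lemma absolutely_integrable_mult_continuous:
  fixes r g :: "real \<Rightarrow> real"
  assumes r: "r absolutely_integrable_on {a..b}" and g: "continuous_on {a..b} g"
  shows "(\<lambda>x. r x * g x) absolutely_integrable_on {a..b}"
proof -
  have "bounded (g ` {a..b})" using g by (simp add: compact_continuous_image compact_imp_bounded)
  then obtain B where B: "\<And>x. x \<in> {a..b} \<Longrightarrow> \<bar>g x\<bar> \<le> B" by (metis bounded_iff image_eqI real_norm_def)
  have ri: "integrable (lebesgue_on {a..b}) r"
    using r by (simp add: absolutely_integrable_iff_integrable_lebesgue_on)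
  have gm: "g \<in> borel_measurable (lebesgue_on {a..b})"
    using g by (intro continuous_imp_measurable_on_sets_lebesgue) auto
  have "integrable (lebesgue_on {a..b}) (\<lambda>x. r x * g x)"
  proof (rule Bochner_Integration.integrable_bound)
    show "integrable (lebesgue_on {a..b}) (\<lambda>x. B * r x)" using ri by simp
    show "AE x in lebesgue_on {a..b}. norm (r x * g x) \<le> norm (B * r x)"
    proof (rule AE_I2)
      fix x assume "x \<in> space (lebesgue_on {a..b})"
      then have "\<bar>g x\<bar> \<le> \<bar>B\<bar>" using B[of x] by auto
      then show "norm (r x * g x) \<le> norm (B * r x)"
        by (simp add: abs_mult mult.commute mult_right_mono)
    qed
  qed (use ri gm in measurable)
  then show ?thesis by (simp add: absolutely_integrable_iff_integrable_lebesgue_on)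
qed

text \<open>Up to a bounded telescoping sum, the mean of \<open>sin\<^sup>2 = (1 - cos)/2\<close> is 1/2, for \<open>x\<close> away from the integers.\<close>

lemma mean_sine_square_tendsto:
  assumes x: "x \<in> {0<..<1::real}"
  shows "(\<lambda>N. (\<Sum>n<N. (sin (real (m + n) * pi * x))\<^sup>2) / real N) \<longlonglongrightarrow> 1/2"
proof -
  define \<theta> where "\<theta> = pi * x"
  have "sin \<theta> > 0" using x unfolding \<theta>_def by (intro sin_gt_zero) auto
  define c where "c = (\<lambda>N. \<Sum>n<N. cos (2 * real (m + n) * \<theta>))"
  have step: "2 * sin \<theta> * cos (2 * real j * \<theta>)
      = sin ((2 * real (Suc j) - 1) * \<theta>) - sin ((2 * real j - 1) * \<theta>)" for j
    by (simp add: algebra_simps sin_add sin_diff)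
  have "2 * sin \<theta> * c N = sin ((2 * real (m + N) - 1) * \<theta>) - sin ((2 * real m - 1) * \<theta>)" for N
  proof (induction N)
    case (Suc N)
    have "2 * sin \<theta> * c (Suc N) = 2 * sin \<theta> * c N + 2 * sin \<theta> * cos (2 * real (m + N) * \<theta>)"
      by (simp add: c_def algebra_simps)
    then show ?case using Suc step[of "m + N"] by simp
  qed (simp add: c_def)
  note tele = this
  have "\<bar>2 * sin \<theta> * c N\<bar> \<le> 2" for N
    unfolding tele
    using abs_sin_le_one[of "(2 * real (m + N) - 1) * \<theta>"] abs_sin_le_one[of "(2 * real m - 1) * \<theta>"]
    by linarith
  then have cb: "\<bar>c N\<bar> \<le> 1 / sin \<theta>" for N
    using \<open>sin \<theta> > 0\<close> by (simp add: abs_mult field_simps)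
  have "(\<lambda>N. c N / real N) \<longlonglongrightarrow> 0"
  proof (rule Lim_null_comparison)
    show "\<forall>\<^sub>F N in sequentially. norm (c N / real N) \<le> (1 / sin \<theta>) / real N"
    proof (intro always_eventually allI)
      fix N
      have "\<bar>c N\<bar> / real N \<le> (1 / sin \<theta>) / real N"
        using cb by (intro divide_right_mono) auto
      then show "norm (c N / real N) \<le> (1 / sin \<theta>) / real N" by simp
    qed
    show "(\<lambda>N. (1 / sin \<theta>) / real N) \<longlonglongrightarrow> 0" by (rule lim_const_over_n)
  qed
  then have "(\<lambda>N. 1/2 - c N / real N / 2) \<longlonglongrightarrow> 1/2 - 0 / 2"
    by (intro tendsto_intros) simp_all
  moreover have "\<forall>\<^sub>F N in sequentially. 1/2 - c N / real N / 2
      = (\<Sum>n<N. (sin (real (m + n) * pi * x))\<^sup>2) / real N"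
  proof (rule eventually_sequentiallyI[of 1])
    fix N :: nat assume N: "N \<ge> 1"
    have "(sin (real j * pi * x))\<^sup>2 = 1/2 - cos (2 * real j * \<theta>) / 2" for j
      using cos_double_sin[of "real j * \<theta>"] by (simp add: \<theta>_def mult.assoc diff_divide_distrib)
    then have "(\<Sum>n<N. (sin (real (m + n) * pi * x))\<^sup>2) = real N / 2 - c N / 2"
      by (simp add: c_def sum_subtractf sum_divide_distrib del: of_nat_add)
    then have "(\<Sum>n<N. (sin (real (m + n) * pi * x))\<^sup>2) / real N = (real N / 2 - c N / 2) / real N"
      by (rule arg_cong)
    then show "1/2 - c N / real N / 2 = (\<Sum>n<N. (sin (real (m + n) * pi * x))\<^sup>2) / real N"
      using N by (simp add: diff_divide_distrib)
  qed
  ultimately show ?thesis by (auto intro: Lim_transform_eventually)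
qed

text \<open>This takes the place of the Riemann-Lebesgue lemma: the Cesaro means of \<open>sin\<^sup>2(n\<pi>x)\<close> converge boundedly
  to 1/2, so dominated convergence applies directly to any integrable function.\<close>

lemma integral_eq_0_if_sine_square_moments_null:
  fixes r :: "real \<Rightarrow> real"
  assumes r: "r absolutely_integrable_on {0..1}"
    and lim: "(\<lambda>n. integral {0..1} (\<lambda>x. r x * (sin (real n * pi * x))\<^sup>2)) \<longlonglongrightarrow> 0"
  shows "integral {0..1} r = 0"
proof -
  let ?I = "\<lambda>n. integral {0..1} (\<lambda>x. r x * (sin (real n * pi * x))\<^sup>2)"
  have int: "(\<lambda>x. r x * (sin (real n * pi * x))\<^sup>2) integrable_on {0..1}" for n
    by (intro set_lebesgue_integral_eq_integral absolutely_integrable_mult_continuous r continuous_intros)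
  have "\<bar>integral {0..1} r\<bar> \<le> 0 + e" if "e > 0" for e
  proof -
    have "\<forall>\<^sub>F n in sequentially. dist (?I n) 0 < e / 2"
      using lim \<open>e > 0\<close> by (intro tendstoD) auto
    then obtain m where m: "\<And>n. n \<ge> m \<Longrightarrow> \<bar>?I n\<bar> < e / 2"
      by (auto simp: eventually_sequentially dist_real_def)
    define A where "A = (\<lambda>N x. r x * ((\<Sum>n<N. (sin (real (m + n) * pi * x))\<^sup>2) / real N))"
    have AI: "(A N has_integral (\<Sum>n<N. ?I (m + n)) / real N) {0..1}" for N
    proof -
      have "((\<lambda>x. (\<Sum>n<N. r x * (sin (real (m + n) * pi * x))\<^sup>2) / real N)
          has_integral (\<Sum>n<N. ?I (m + n)) / real N) {0..1}"
        by (intro has_integral_divide has_integral_sum integrable_integral int) auto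
      then show ?thesis by (simp add: A_def sum_distrib_left)
    qed
    have "(\<lambda>N. integral {0<..<1} (A N)) \<longlonglongrightarrow> integral {0<..<1} (\<lambda>x. r x * (1/2))"
    proof (rule dominated_convergence)
      show "A N integrable_on {0<..<1}" for N
        using has_integral_integrable[OF AI[of N]] by (simp add: integrable_on_open_interval_real)
      show "(\<lambda>x. \<bar>r x\<bar>) integrable_on {0<..<1}"
        using absolutely_integrable_norm[OF r]
        by (simp add: comp_def set_lebesgue_integral_eq_integral integrable_on_open_interval_real)
      show "norm (A N x) \<le> \<bar>r x\<bar>" for N x
      proof -
        have "(\<Sum>n<N. (sin (real (m + n) * pi * x))\<^sup>2) \<le> (\<Sum>n<N. 1)"
          by (intro sum_mono) (simp add: abs_square_le_1)
        then have "(\<Sum>n<N. (sin (real (m + n) * pi * x))\<^sup>2) / real N \<le> 1"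
          by (cases "N = 0") (simp_all add: field_simps)
        moreover have "(\<Sum>n<N. (sin (real (m + n) * pi * x))\<^sup>2) / real N \<ge> 0"
          by (intro divide_nonneg_nonneg sum_nonneg) auto
        ultimately have "\<bar>(\<Sum>n<N. (sin (real (m + n) * pi * x))\<^sup>2) / real N\<bar> \<le> 1" by simp
        then show ?thesis
          unfolding A_def real_norm_def abs_mult by (intro mult_left_le) auto
      qed
      show "(\<lambda>N. A N x) \<longlonglongrightarrow> r x * (1/2)" if "x \<in> {0<..<1}" for x
        unfolding A_def by (intro tendsto_mult tendsto_const mean_sine_square_tendsto that)
    qed
    then have "(\<lambda>N. (\<Sum>n<N. ?I (m + n)) / real N) \<longlonglongrightarrow> integral {0..1} r / 2"
      by (simp add: integral_unique[OF AI] flip: integral_open_interval_real)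
    then have "(\<lambda>N. \<bar>(\<Sum>n<N. ?I (m + n)) / real N\<bar>) \<longlonglongrightarrow> \<bar>integral {0..1} r / 2\<bar>"
      by (rule tendsto_rabs)
    moreover have "\<bar>(\<Sum>n<N. ?I (m + n)) / real N\<bar> \<le> e / 2" for N
    proof -
      have "\<bar>\<Sum>n<N. ?I (m + n)\<bar> \<le> (\<Sum>n<N. e / 2)"
        by (intro order_trans[OF sum_abs] sum_mono) (rule less_imp_le[OF m[OF le_add1]])
      then show ?thesis using \<open>e > 0\<close> by (cases "N = 0") (auto simp: abs_divide field_simps)
    qed
    ultimately have "\<bar>integral {0..1} r / 2\<bar> \<le> e / 2"
      by (intro LIMSEQ_le_const2) auto
    then show ?thesis by simp
  qed
  then have "\<bar>integral {0..1} r\<bar> \<le> 0" by (rule field_le_epsilon)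
  then show ?thesis by simp
qed

text \<open>Replacing one factor \<open>sin n\<pi>x\<close> by a function at uniform distance \<open>O(1/n)\<close> does not change the limit.\<close>

lemma integral_eq_0_if_near_sine_moments:
  fixes r :: "real \<Rightarrow> real" and \<phi> :: "nat \<Rightarrow> real \<Rightarrow> real"
  assumes r: "r absolutely_integrable_on {0..1}"
    and near: "\<And>n x. \<lbrakk>n \<ge> m; x \<in> {0..1}\<rbrakk> \<Longrightarrow> \<bar>\<phi> n x - sin (real n * pi * x)\<bar> \<le> K / real n"
    and zero: "\<And>n. n \<ge> m \<Longrightarrow> ((\<lambda>x. \<phi> n x * (r x * sin (real n * pi * x))) has_integral 0) {0..1}"
  shows "integral {0..1} r = 0"
proof (rule integral_eq_0_if_sine_square_moments_null[OF r])
  let ?s = "\<lambda>n x. sin (real n * pi * x)"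
  let ?R = "integral {0..1} (\<lambda>x. \<bar>r x\<bar>)"
  have ar: "(\<lambda>x. \<bar>r x\<bar>) integrable_on {0..1}"
    using absolutely_integrable_norm[OF r] by (simp add: comp_def set_lebesgue_integral_eq_integral)
  have "\<bar>integral {0..1} (\<lambda>x. r x * (?s n x)\<^sup>2)\<bar> \<le> (K * ?R) / real n" if n: "n \<ge> m" for n
  proof -
    have int: "(\<lambda>x. r x * (?s n x)\<^sup>2) integrable_on {0..1}"
      by (intro set_lebesgue_integral_eq_integral absolutely_integrable_mult_continuous r continuous_intros)
    have d: "((\<lambda>x. r x * (?s n x)\<^sup>2 - \<phi> n x * (r x * ?s n x)) has_integral
        integral {0..1} (\<lambda>x. r x * (?s n x)\<^sup>2) - 0) {0..1}"
      by (intro has_integral_diff integrable_integral[OF int] zero n)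
    have "norm (integral {0..1} (\<lambda>x. r x * (?s n x)\<^sup>2 - \<phi> n x * (r x * ?s n x)))
        \<le> integral {0..1} (\<lambda>x. (K / real n) * \<bar>r x\<bar>)"
    proof (rule integral_norm_bound_integral)
      show "(\<lambda>x. r x * (?s n x)\<^sup>2 - \<phi> n x * (r x * ?s n x)) integrable_on {0..1}" using d by blast
      show "(\<lambda>x. (K / real n) * \<bar>r x\<bar>) integrable_on {0..1}" using ar by (rule integrable_on_mult_right)
      fix x :: real assume x: "x \<in> {0..1}"
      have "r x * (?s n x)\<^sup>2 - \<phi> n x * (r x * ?s n x) = - ((\<phi> n x - ?s n x) * ?s n x * r x)"
        by (simp add: algebra_simps power2_eq_square)
      then have "norm (r x * (?s n x)\<^sup>2 - \<phi> n x * (r x * ?s n x))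
          = \<bar>\<phi> n x - ?s n x\<bar> * \<bar>?s n x\<bar> * \<bar>r x\<bar>" by (simp add: abs_mult)
      also have "\<dots> \<le> (K / real n) * 1 * \<bar>r x\<bar>"
        using near[OF n x] order_trans[OF abs_ge_zero near[OF n x]]
        by (intro mult_right_mono mult_mono) auto
      finally show "norm (r x * (?s n x)\<^sup>2 - \<phi> n x * (r x * ?s n x)) \<le> (K / real n) * \<bar>r x\<bar>" by simp
    qed
    then show ?thesis using integral_unique[OF d] by simp
  qed
  then have "\<forall>\<^sub>F n in sequentially. norm (integral {0..1} (\<lambda>x. r x * (?s n x)\<^sup>2)) \<le> (K * ?R) / real n"
    by (intro eventually_sequentiallyI[of m]) simp
  then show "(\<lambda>n. integral {0..1} (\<lambda>x. r x * (?s n x)\<^sup>2)) \<longlonglongrightarrow> 0"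
    by (rule Lim_null_comparison[OF _ lim_const_over_n])
qed

section \<open>Vanishing of the potential\<close>

text \<open>Lagrange's identity, integrated against a test function \<open>z\<close> vanishing at both endpoints.\<close>

lemma lagrange_identity:
  fixes \<phi> \<phi>1 z z1 z2 p :: "real \<Rightarrow> real"
  assumes \<phi>: "\<And>x. x \<in> {0..1} \<Longrightarrow> (\<phi> has_vector_derivative \<phi>1 x) (at x within {0..1})"
    and \<phi>1: "\<And>x. x \<in> {0..1} \<Longrightarrow> (\<phi>1 has_vector_derivative p x * \<phi> x) (at x within {0..1})"
    and p: "continuous_on {0..1} p"
    and z: "\<And>x. x \<in> {0..1} \<Longrightarrow> (z has_vector_derivative z1 x) (at x within {0..1})"
    and ac: "absolutely_continuous_on_interval 0 1 z1" and N: "negligible N"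
    and z1: "\<And>x. x \<in> {0..1} - N \<Longrightarrow> (z1 has_vector_derivative z2 x) (at x within {0..1})"
    and bc: "\<phi> 0 = 0" "\<phi> 1 = 0" "z 0 = 0" "z 1 = 0"
  shows "((\<lambda>x. \<phi> x * (p x * z x - z2 x)) has_integral 0) {0..1}"
proof -
  have c\<phi>: "continuous_on {0..1} \<phi>" using \<phi> by (rule continuous_on_vector_derivative)
  have c\<phi>1: "continuous_on {0..1} \<phi>1" using \<phi>1 by (rule continuous_on_vector_derivative)
  have "absolutely_continuous_on_interval 0 1 (\<lambda>x. \<phi>1 x * z x - \<phi> x * z1 x)"
    by (intro AC_diff AC_mult ac AC_C1[OF \<phi> c\<phi>1] AC_C1[OF z AC_imp_continuous_on[OF ac]]
        AC_C1[OF \<phi>1] continuous_intros p c\<phi>)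
  then have "((\<lambda>x. \<phi> x * (p x * z x - z2 x)) has_integral
      (\<phi>1 1 * z 1 - \<phi> 1 * z1 1) - (\<phi>1 0 * z 0 - \<phi> 0 * z1 0)) {0..1}"
  proof (rule AC_fundamental_theorem_of_calculus[OF _ _ N])
    fix x :: real assume x: "x \<in> {0..1} - N"
    show "((\<lambda>x. \<phi>1 x * z x - \<phi> x * z1 x) has_vector_derivative \<phi> x * (p x * z x - z2 x))
        (at x within {0..1})"
      by (rule has_vector_derivative_eq_rhs[OF has_vector_derivative_diff[OF
              has_vector_derivative_mult[OF \<phi>1 z] has_vector_derivative_mult[OF \<phi> z1[OF x]]]])
        (use x in \<open>auto simp: algebra_simps\<close>)
  qed simp
  then show ?thesis by (simp add: bc)
qed

theorem theorem6:
  fixes q :: "real \<Rightarrow> real"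
  assumes "q \<in> sobolev_W21"
    and "\<forall>k\<in>{0, 1}. (deriv01 ^^ k) q 0 = (deriv01 ^^ k) q 1"
    and "{of_real ((real n * pi)\<^sup>2) |n. n \<ge> 1} \<subseteq> op_spectrum (dirichlet_operator q)"
  shows "AE x in lebesgue_on {0<..<1}. q x = 0"
proof -
  define q1 where "q1 = deriv01 q"
  define q2 where "q2 = deriv01 q1"
  have tw: "twice_AC q" and q2i: "q2 absolutely_integrable_on {0..1}"
    using assms(1) by (auto simp: sobolev_W21_def q1_def q2_def absolutely_integrable_iff_integrable_lebesgue_on)
  have per: "q1 0 = q1 1" using assms(2) by (simp add: q1_def)
  have qd: "(q has_vector_derivative q1 x) (at x within {0..1})" if "x \<in> {0..1}" for x
    using twice_AC_imp(1)[OF tw that] by (simp add: q1_def)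
  have acq1: "absolutely_continuous_on_interval 0 1 q1"
    using twice_AC_imp(2)[OF tw] by (simp add: q1_def)
  obtain S where S: "negligible S" "\<And>x. x \<in> {0..1} - S \<Longrightarrow>
      (q1 has_vector_derivative q2 x) (at x within {0..1})"
    using twice_AC_imp(3)[OF tw] unfolding q1_def q2_def by blast
  have cq1: "continuous_on {0..1} q1" by (rule AC_imp_continuous_on[OF acq1])
  have cq: "continuous_on {0..1} q" using qd by (rule continuous_on_vector_derivative)
  have acq: "absolutely_continuous_on_interval 0 1 q" by (rule AC_C1[OF qd cq1])
  define Q where "Q = (\<lambda>x. integral {0..x} q)"
  have Qd: "(Q has_vector_derivative q x) (at x within {0..1})" if "x \<in> {0..1}" for x
    unfolding Q_def by (rule integral_has_vector_derivative[OF cq that])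
  have cQ: "continuous_on {0..1} Q" using Qd by (rule continuous_on_vector_derivative)
  have acQ: "absolutely_continuous_on_interval 0 1 Q" by (rule AC_C1[OF Qd cq])
  have Q0: "Q 0 = 0" by (simp add: Q_def)
  have "bounded (q ` {0..1})" using cq by (simp add: compact_continuous_image compact_imp_bounded)
  then obtain M where M: "\<And>x. x \<in> {0..1} \<Longrightarrow> \<bar>q x\<bar> \<le> M" by (metis bounded_iff image_eqI real_norm_def)
  obtain m0 :: nat where m0: "2 * M \<le> real m0" using real_arch_simple by blast
  \<comment> \<open>for \<open>n \<ge> m\<close>, \<open>k = n\<pi>\<close> satisfies \<open>k \<ge> 2 sup |q|\<close> and \<open>k > 0\<close>\<close>
  define m where "m = max 1 m0"
  define E where "E = (\<lambda>n \<phi> \<phi>1. (\<forall>x\<in>{0..1}. (\<phi> has_vector_derivative \<phi>1 x) (at x within {0..1})) \<and>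
      (\<forall>x\<in>{0..1}. (\<phi>1 has_vector_derivative (q x - (real n * pi)\<^sup>2) * \<phi> x) (at x within {0..1})) \<and>
      \<phi> 0 = 0 \<and> \<phi> 1 = 0 \<and> (\<forall>x\<in>{0..1}. \<bar>\<phi> x - sin (real n * pi * x)\<bar> \<le> (2 * M / pi) / real n))"
  have kpos: "real n * pi > 0" "2 * M \<le> real n * pi" if "n \<ge> m" for n
  proof -
    show "real n * pi > 0" using that by (simp add: m_def)
    have "2 * M \<le> real n * 1" using m0 that by (simp add: m_def)
    also have "\<dots> \<le> real n * pi" using pi_ge_two by (intro mult_left_mono) auto
    finally show "2 * M \<le> real n * pi" .
  qed
  have "\<exists>\<phi> \<phi>1. E n \<phi> \<phi>1" if n: "n \<ge> m" for n
  proof -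
    obtain \<phi> \<phi>1 where \<phi>: "\<And>x. x \<in> {0..1} \<Longrightarrow> (\<phi> has_vector_derivative \<phi>1 x) (at x within {0..1})"
      "\<And>x. x \<in> {0..1} \<Longrightarrow> (\<phi>1 has_vector_derivative (q x - (real n * pi)\<^sup>2) * \<phi> x) (at x within {0..1})"
      "\<phi> 0 = 0" "\<phi>1 0 = real n * pi"
      "\<And>x. x \<in> {0..1} \<Longrightarrow> \<bar>\<phi> x - sin (real n * pi * x)\<bar> \<le> 2 * M / (real n * pi)"
      by (rule dirichlet_solution_near_sine[OF cq M kpos[OF n]]) blast+
    have "complex_of_real ((real n * pi)\<^sup>2) \<notin> resolvent_set (dirichlet_operator q)"
      using assms(3) n unfolding op_spectrum_def m_def by auto
    then have "\<phi> 1 = 0"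
      using resolvent_set_dirichlet_operator[OF cq M kpos[OF n] \<phi>(1-4)] by blast
    moreover have "2 * M / (real n * pi) = (2 * M / pi) / real n" by simp
    ultimately have "E n \<phi> \<phi>1" unfolding E_def using \<phi>(1-3,5) by metis
    then show ?thesis by blast
  qed
  then obtain \<phi> \<phi>1 where E: "\<And>n. n \<ge> m \<Longrightarrow> E n (\<phi> n) (\<phi>1 n)" by metis
  have near: "\<bar>\<phi> n x - sin (real n * pi * x)\<bar> \<le> (2 * M / pi) / real n" if "n \<ge> m" "x \<in> {0..1}" for n x
    using E[OF that(1)] that(2) by (simp add: E_def)
  have test: "((\<lambda>x. \<phi> n x * ((q x - (real n * pi)\<^sup>2) * z x - z2 x)) has_integral 0) {0..1}"
    if n: "n \<ge> m"
      and z: "\<And>x. x \<in> {0..1} \<Longrightarrow> (z has_vector_derivative z1 x) (at x within {0..1})"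
        "absolutely_continuous_on_interval 0 1 z1"
        "\<And>x. x \<in> {0..1} - S \<Longrightarrow> (z1 has_vector_derivative z2 x) (at x within {0..1})"
        "z 0 = 0" "z 1 = 0" for n z z1 z2
    by (rule lagrange_identity[of "\<phi> n" "\<phi>1 n" _ z z1 S z2])
      (use E[OF n] z S(1) in \<open>auto simp: E_def intro!: continuous_intros cq\<close>)
  have sd: "((\<lambda>x. sin (k * x)) has_vector_derivative k * cos (k * x)) (at x within {0..1})"
    and cd: "((\<lambda>x. cos (k * x)) has_vector_derivative - (k * sin (k * x))) (at x within {0..1})" for k x :: real
    by (auto intro!: derivative_eq_intros simp flip: has_real_derivative_iff_has_vector_derivative)
  have acsc: "absolutely_continuous_on_interval 0 1 (\<lambda>x. sin (k * x))"
    "absolutely_continuous_on_interval 0 1 (\<lambda>x. cos (k * x))" for k :: real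
    by (rule AC_C1[OF sd], intro continuous_intros) (rule AC_C1[OF cd], intro continuous_intros)
  have acc: "absolutely_continuous_on_interval 0 1 (\<lambda>x. c)" for c :: real
    by (rule AC_lipschitz[of _ _ _ 0]) simp

  have ccd: "((\<lambda>x. c * g x) has_vector_derivative c * g') (at x within T)"
    if "(g has_vector_derivative g') (at x within T)" for c g' x :: real and g T
    using that by (rule has_vector_derivative_mult_right)

  \<comment> \<open>the test function \<open>sin kx\<close>\<close>
  have Q1: "Q 1 = 0"
    unfolding Q_def
  proof (rule integral_eq_0_if_near_sine_moments[OF _ near])
    show "q absolutely_integrable_on {0..1}" by (rule absolutely_integrable_continuous_real[OF cq])
    fix n assume n: "n \<ge> m"
    let ?k = "real n * pi"
    have "((\<lambda>x. \<phi> n x * ((q x - ?k\<^sup>2) * sin (?k * x) - ?k * - (?k * sin (?k * x)))) has_integral 0) {0..1}"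
    proof (rule test[OF n sd])
      show "((\<lambda>x. ?k * cos (?k * x)) has_vector_derivative ?k * - (?k * sin (?k * x))) (at x within {0..1})" for x
        by (rule ccd[OF cd])
    qed (simp_all add: AC_mult acc acsc)
    then show "((\<lambda>x. \<phi> n x * (q x * sin (?k * x))) has_integral 0) {0..1}"
      by (simp add: algebra_simps power2_eq_square)
  qed

  \<comment> \<open>the WKB coefficient, chosen so that \<open>2 a' = q b - b''\<close> for \<open>b = - Q/2\<close>; this removes the
    \<open>cos kx\<close> terms from the residual\<close>
  define a where "a = (\<lambda>x. (1/4) * q x - (1/8) * (Q x * Q x))"
  define a1 where "a1 = (\<lambda>x. (1/4) * q1 x - (1/4) * (Q x * q x))"
  define a2 where "a2 = (\<lambda>x. (1/4) * q2 x - (1/4) * (Q x * q1 x + q x * q x))"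
  have ad: "(a has_vector_derivative a1 x) (at x within {0..1})" if x: "x \<in> {0..1}" for x
    unfolding a_def a1_def
    by (rule has_vector_derivative_eq_rhs[OF has_vector_derivative_diff[OF ccd[OF qd[OF x]]
          ccd[OF has_vector_derivative_mult[OF Qd[OF x] Qd[OF x]]]]]) (simp add: algebra_simps)
  have a1d: "(a1 has_vector_derivative a2 x) (at x within {0..1})" if x: "x \<in> {0..1} - S" for x
    unfolding a1_def a2_def
    by (rule has_vector_derivative_eq_rhs[OF has_vector_derivative_diff[OF ccd[OF S(2)[OF x]]
          ccd[OF has_vector_derivative_mult[OF Qd qd]]]]) (use x in \<open>auto simp: algebra_simps\<close>)
  have aca: "absolutely_continuous_on_interval 0 1 a"
    unfolding a_def by (intro AC_diff AC_mult acc acq acQ)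
  have aca1: "absolutely_continuous_on_interval 0 1 a1"
    unfolding a1_def by (intro AC_diff AC_mult acc acq acQ acq1)
  have ca: "continuous_on {0..1} a" by (rule AC_imp_continuous_on[OF aca])
  have a2i: "a2 absolutely_integrable_on {0..1}"
    unfolding a2_def
    by (intro set_integral_diff set_integrable_mult_right q2i absolutely_integrable_continuous_real
        continuous_intros cq cq1 cQ)
  have qai: "(\<lambda>x. q x * a x) absolutely_integrable_on {0..1}"
    by (intro absolutely_integrable_continuous_real continuous_intros cq ca)

  have "integral {0..1} (\<lambda>x. q x * a x - a2 x) = 0"
  proof (rule integral_eq_0_if_near_sine_moments[OF _ near])
    show "(\<lambda>x. q x * a x - a2 x) absolutely_integrable_on {0..1}"
      by (rule set_integral_diff[OF qai a2i])
    fix n assume n: "n \<ge> m"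
    define k where "k = real n * pi"
    have k: "k > 0" using kpos(1)[OF n] by (simp add: k_def)
    \<comment> \<open>amplitudes of \<open>sin kx\<close> and \<open>cos kx\<close> with their derivatives; the summands 0 are the derivatives
      of the constant 1\<close>
    define A where "A = (\<lambda>x. 1 + inverse (k\<^sup>2) * a x)"
    define A1 where "A1 = (\<lambda>x. 0 + inverse (k\<^sup>2) * a1 x)"
    define A2 where "A2 = (\<lambda>x. 0 + inverse (k\<^sup>2) * a2 x)"
    define B where "B = (\<lambda>x. - inverse (2 * k) * Q x)"
    define B1 where "B1 = (\<lambda>x. - inverse (2 * k) * q x)"
    define B2 where "B2 = (\<lambda>x. - inverse (2 * k) * q1 x)"
    have Ad: "(A has_vector_derivative A1 x) (at x within {0..1})" if "x \<in> {0..1}" for x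
      unfolding A_def A1_def by (intro has_vector_derivative_add has_vector_derivative_const ccd ad that)
    have A1d: "(A1 has_vector_derivative A2 x) (at x within {0..1})" if "x \<in> {0..1} - S" for x
      unfolding A1_def A2_def by (intro has_vector_derivative_add has_vector_derivative_const ccd a1d that)
    have Bd: "(B has_vector_derivative B1 x) (at x within {0..1})" if "x \<in> {0..1}" for x
      unfolding B_def B1_def by (intro ccd Qd that)
    have B1d: "(B1 has_vector_derivative B2 x) (at x within {0..1})" if "x \<in> {0..1}" for x
      unfolding B1_def B2_def by (intro ccd qd that)
    have acAB: "absolutely_continuous_on_interval 0 1 A" "absolutely_continuous_on_interval 0 1 A1"
      "absolutely_continuous_on_interval 0 1 B" "absolutely_continuous_on_interval 0 1 B1"
      unfolding A_def A1_def B_def B1_def by (intro AC_add AC_mult acc aca aca1 acQ acq)+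
    define z where "z = (\<lambda>x. A x * sin (k * x) + B x * cos (k * x))"
    define z1 where "z1 = (\<lambda>x. (A1 x - k * B x) * sin (k * x) + (k * A x + B1 x) * cos (k * x))"
    define z2 where "z2 = (\<lambda>x. (A2 x - 2 * k * B1 x - k * (k * A x)) * sin (k * x)
        + (2 * k * A1 x + B2 x - k * (k * B x)) * cos (k * x))"
    have "((\<lambda>x. \<phi> n x * ((q x - (real n * pi)\<^sup>2) * z x - z2 x)) has_integral 0) {0..1}"
    proof (rule test[OF n])
      show "(z has_vector_derivative z1 x) (at x within {0..1})" if x: "x \<in> {0..1}" for x
        unfolding z_def z1_def
        by (rule has_vector_derivative_eq_rhs[OF has_vector_derivative_add[OF
              has_vector_derivative_mult[OF Ad[OF x] sd] has_vector_derivative_mult[OF Bd[OF x] cd]]])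
          (simp add: algebra_simps)
      show "absolutely_continuous_on_interval 0 1 z1"
        unfolding z1_def by (intro AC_add AC_diff AC_mult acsc acc acAB)
      show "(z1 has_vector_derivative z2 x) (at x within {0..1})" if x: "x \<in> {0..1} - S" for x
      proof -
        have x01: "x \<in> {0..1}" using x by auto
        show ?thesis
          unfolding z1_def z2_def
          by (rule has_vector_derivative_eq_rhs[OF has_vector_derivative_add[OF
                has_vector_derivative_mult[OF has_vector_derivative_diff[OF A1d[OF x] ccd[OF Bd[OF x01]]] sd]
                has_vector_derivative_mult[OF has_vector_derivative_add[OF ccd[OF Ad[OF x01]] B1d[OF x01]] cd]]])
            (simp add: algebra_simps)
      qed
      show "z 0 = 0" by (simp add: z_def B_def Q0)
      show "z 1 = 0" by (simp add: z_def B_def Q1 k_def)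
    qed
    moreover have "(q x - k\<^sup>2) * z x - z2 x = inverse (k\<^sup>2) * ((q x * a x - a2 x) * sin (k * x))" for x
    proof -
      have "(q x - k\<^sup>2) * A x - (A2 x - 2 * k * B1 x - k * (k * A x)) = inverse (k\<^sup>2) * (q x * a x - a2 x)"
        using k by (simp add: A_def A2_def B1_def field_simps power2_eq_square)
      moreover have "(q x - k\<^sup>2) * B x - (2 * k * A1 x + B2 x - k * (k * B x)) = 0"
        using k by (simp add: A1_def B_def B2_def a1_def field_simps power2_eq_square)
      moreover have "(q x - k\<^sup>2) * z x - z2 x
        = ((q x - k\<^sup>2) * A x - (A2 x - 2 * k * B1 x - k * (k * A x))) * sin (k * x)
          + ((q x - k\<^sup>2) * B x - (2 * k * A1 x + B2 x - k * (k * B x))) * cos (k * x)"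
        by (simp add: z_def z2_def algebra_simps)
      ultimately show ?thesis by simp
    qed
    ultimately have "((\<lambda>x. \<phi> n x * (inverse (k\<^sup>2) * ((q x * a x - a2 x) * sin (k * x)))) has_integral 0) {0..1}"
      by (simp add: k_def)
    from has_integral_mult_right[OF this, of "k\<^sup>2"]
    have "((\<lambda>x. k\<^sup>2 * (\<phi> n x * (inverse (k\<^sup>2) * ((q x * a x - a2 x) * sin (k * x))))) has_integral 0) {0..1}"
      by simp
    moreover have "k\<^sup>2 * (\<phi> n x * (inverse (k\<^sup>2) * ((q x * a x - a2 x) * sin (k * x))))
        = \<phi> n x * ((q x * a x - a2 x) * sin (real n * pi * x))" for x
      using k unfolding k_def[symmetric] by simp
    ultimately show "((\<lambda>x. \<phi> n x * ((q x * a x - a2 x) * sin (real n * pi * x))) has_integral 0) {0..1}"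
      by simp
  qed
  moreover have "integral {0..1} a2 = 0"
  proof -
    have "(a2 has_integral a1 1 - a1 0) {0..1}"
      using a1d by (intro AC_fundamental_theorem_of_calculus[OF aca1 _ S(1)]) auto
    moreover have "a1 1 - a1 0 = 0" by (simp add: a1_def per Q0 Q1)
    ultimately show ?thesis using integral_unique[of a2 "a1 1 - a1 0" "{0..1}"] by simp
  qed
  ultimately have qa0: "integral {0..1} (\<lambda>x. q x * a x) = 0"
    using qai a2i by (simp add: integral_diff set_lebesgue_integral_eq_integral)

  \<comment> \<open>\<open>q Q\<^sup>2\<close> is the derivative of \<open>Q\<^sup>3/3\<close>\<close>
  have "((\<lambda>x. q x * (Q x * Q x)) has_integral (1/3) * (Q 1 * (Q 1 * Q 1)) - (1/3) * (Q 0 * (Q 0 * Q 0))) {0..1}"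
  proof (rule fundamental_theorem_of_calculus)
    fix x :: real assume x: "x \<in> {0..1}"
    show "((\<lambda>x. (1/3) * (Q x * (Q x * Q x))) has_vector_derivative q x * (Q x * Q x)) (at x within {0..1})"
      by (rule has_vector_derivative_eq_rhs[OF ccd[OF has_vector_derivative_mult[OF Qd[OF x]
              has_vector_derivative_mult[OF Qd[OF x] Qd[OF x]]]]]) (simp add: algebra_simps)
  qed simp
  then have QQ: "((\<lambda>x. q x * (Q x * Q x)) has_integral 0) {0..1}" by (simp add: Q0 Q1)
  have "((\<lambda>x. q x * a x) has_integral 0) {0..1}"
    using qai qa0 by (metis has_integral_integral set_lebesgue_integral_eq_integral(1))
  from has_integral_add[OF has_integral_mult_right[OF this, of 4] has_integral_mult_right[OF QQ, of "1/2"]]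
  have "((\<lambda>x. q x * q x) has_integral 0) {0..1}"
    by (simp add: a_def algebra_simps)
  then have "q x * q x = 0" if "x \<in> {0..1}" for x
    using that by (intro has_integral_0_cbox_imp_0[of 0 1 "\<lambda>x. q x * q x" x])
      (auto intro!: continuous_intros cq)
  then show ?thesis
    by (intro AE_unit_intervalI[of "{}"]) auto
qed

end
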